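(* Fix $j\in\mathbb N$ and write $\phi=\phi_j$, $\lambda=\lambda_j$. Let $0<x\le 1$ and suppose $\phi'(x)$ exists. Then $$x\phi'(x)+\phi(x)-\lambda\phi(1)K(x,1)=P(x),$$ where $P(x)=-\lambda\int_0^1K(x,y)Q(y)\,dy$ and $Q(y)=y\phi'(y)$ at those $y$ where $\phi'(y)$ exists.
   Context: Let $K:[0,1]\times[0,1]\to\mathbb R$ be defined by $K(x,y)=\frac12-\{(xy)^{-1}\}$ if $0<x,y\le 1$, and $K(x,y)=0$ if $0\le x,y\le1$ and $xy=0$, where $\{\alpha\}=\alpha-\lfloor\alpha\rfloor$. Let $L^2([0,1])$ denote the space of real-valued Lebesgue measurable square-integrable functions on $[0,1]$, with $\langle f,g\rangle=\int_0^1 f(x)g(x)\,dx$ and $\|f\|=\langle f,f\rangle^{1/2}$. A function $\phi$ is an eigenfunction of $K$ (with eigenvalue $\lambda\in\mathbb R$) if $\phi\in L^2([0,1])$, $\|\phi\|>0$, and $\phi(x)=\lambda\int_0^1 K(x,y)\phi(y)\,dy$ for every $x\in[0,1]$. Let $\phi_1,\phi_2,\ldots$ be a maximal orthonormal system in $L^2([0,1])$ of eigenfunctions of $K$, $\phi_j$ having the nonzero real eigenvalue $\lambda_j$, numbered so that $0<|\lambda_1|\le|\lambda_2|\le\cdots$ and $\lambda_j\ge\lambda_{j+1}$ whenever $|\lambda_j|=|\lambda_{j+1}|$. (The derivative $\phi'$ exists at all points of $(0,1]$ outside a countable set, and $y\mapsto y\phi'(y)$ is measurable and square integrable on $[0,1]$,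 so $P(x)$ is well defined for each $x\in[0,1]$.) *)

theory Defs
  imports "HOL-Analysis.Analysis"
begin

text \<open>The kernel K(x,y) = 1/2 - frac(1/(xy)) for x y > 0, and 0 if xy = 0
  (only its values on [0,1] x [0,1] matter).\<close>
definition K :: "real \<Rightarrow> real \<Rightarrow> real" where
  "K x y = (if x * y = 0 then 0 else 1/2 - frac (1 / (x * y)))"

definition L2_01 :: "(real \<Rightarrow> real) \<Rightarrow> bool" where
  "L2_01 f \<longleftrightarrow> f \<in> borel_measurable (lebesgue_on {0..1})
      \<and> integrable (lebesgue_on {0..1}) (\<lambda>x. (f x)\<^sup>2)"

definition inner01 :: "(real \<Rightarrow> real) \<Rightarrow> (real \<Rightarrow> real) \<Rightarrow> real" where
  "inner01 f g = (\<integral>x. f x * g x \<partial>lebesgue_on {0..1})"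

definition norm01 :: "(real \<Rightarrow> real) \<Rightarrow> real" where
  "norm01 f = sqrt (inner01 f f)"

definition eigenfunction :: "(real \<Rightarrow> real) \<Rightarrow> real \<Rightarrow> bool" where
  "eigenfunction phi lam \<longleftrightarrow> L2_01 phi \<and> norm01 phi > 0 \<and>
     (\<forall>x\<in>{0..1}. phi x = lam * (\<integral>y. K x y * phi y \<partial>lebesgue_on {0..1}))"

text \<open>Q(y) = y phi'(y) where phi'(y) exists (derivative relative to [0,1]);
  the value elsewhere (a countable set) is irrelevant and set to 0.\<close>
definition Qfun :: "(real \<Rightarrow> real) \<Rightarrow> real \<Rightarrow> real" where
  "Qfun phi y = (if \<exists>D. (phi has_real_derivative D) (at y within {0..1})
      then y * (THE D. (phi has_real_derivative D) (at y within {0..1})) else 0)"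

definition Pfun :: "(real \<Rightarrow> real) \<Rightarrow> real \<Rightarrow> real \<Rightarrow> real" where
  "Pfun phi lam x = - lam * (\<integral>y. K x y * Qfun phi y \<partial>lebesgue_on {0..1})"

definition max_ON_eigensystem :: "(nat \<Rightarrow> real \<Rightarrow> real) \<Rightarrow> (nat \<Rightarrow> real) \<Rightarrow> bool" where
  "max_ON_eigensystem phi lam \<longleftrightarrow>
     (\<forall>j\<ge>1. lam j \<noteq> 0 \<and> eigenfunction (phi j) (lam j))
   \<and> (\<forall>i\<ge>1. \<forall>k\<ge>1. inner01 (phi i) (phi k) = (if i = k then 1 else 0))
   \<and> (\<forall>psi mu. eigenfunction psi mu \<and> mu \<noteq> 0 \<longrightarrow> \<not> (\<forall>j\<ge>1. inner01 psi (phi j) = 0))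
   \<and> (\<forall>j\<ge>1. \<bar>lam j\<bar> \<le> \<bar>lam (j + 1)\<bar>
        \<and> (\<bar>lam j\<bar> = \<bar>lam (j + 1)\<bar> \<longrightarrow> lam j \<ge> lam (j + 1)))"

end

theory Submission
  imports Defs
begin

text \<open>Formally the identity is an integration by parts of \<open>\<integral> K x y * (y * phi y)' dy\<close>, compared with the
  derivative of the eigenvalue equation. Both become rigorous through one formula: if
  \<open>\<bar>F y\<bar> \<le> C * y * sqrt y\<close>, then the integral of \<open>K x y * F' y\<close> over \<open>{0..1}\<close> is
  \<open>(1/2 - 1/x) * F 1 + (\<Sum>n\<ge>1. F (min 1 (1/(n x)))) - (\<integral> F t / t\<^sup>2 dt) / x\<close>, and it is \<open>O(C / x)\<close>.

  Applied to a primitive of \<open>K x\<close>, it bounds the iterated kernel by \<open>2 x / z\<close>, whence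
  \<open>phi x = O(sqrt x)\<close>. Applied to \<open>F = \<integral> phi\<close>, it turns the eigenvalue equation into a series that can be
  differentiated term by term: \<open>phi\<close> is differentiable off the points \<open>1/n\<close>, and differentiable from
  the left everywhere. Applied to \<open>F = y * phi y\<close>, it produces the same series, which is the identity;
  the formula restricted to \<open>{0..x}\<close> also gives \<open>x * phi' x = O(1 / sqrt x)\<close>, so that the integral
  defining \<open>P\<close> converges absolutely.\<close>

section \<open>Elementary estimates for the kernel and its jumps\<close>

lemma abs_K_le: "\<bar>K x y\<bar> \<le> 1/2"
proof (cases "x * y = 0")
  case False
  then have "K x y = 1/2 - frac (1 / (x * y))" by (simp add: K_def)
  then show ?thesis
    using frac_ge_0[of "1 / (x * y)"] frac_lt_1[of "1 / (x * y)"] by linarith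
qed (simp add: K_def)

lemma K_commute: "K x y = K y x"
  by (simp add: K_def mult.commute)

lemma K_eq:
  assumes "0 < x" "0 < y" "real m \<le> 1 / (x * y)" "1 / (x * y) < real m + 1"
  shows "K x y = 1/2 + real m - 1 / (x * y)"
proof -
  have "\<lfloor>1 / (x * y)\<rfloor> = int m"
    using assms by (intro floor_unique) auto
  then show ?thesis using assms by (simp add: K_def frac_def)
qed

lemma DERIV_inverse_mult:
  fixes p u :: real
  assumes "p \<noteq> 0" "u \<noteq> 0"
  shows "((\<lambda>u. 1 / (p * u)) has_real_derivative - 1 / (p * u\<^sup>2)) (at u)"
  using assms by (auto intro!: derivative_eq_intros simp: power2_eq_square)

text \<open>With \<open>p = sqrt (s - x)\<close> and \<open>r = sqrt s\<close> the right-hand side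
  equals \<open>x / ((r + p) * (p * r))\<close>, and \<open>p \<le> r\<close> bounds that
  denominator by \<open>2 * (s * r)\<close>. Terms of size \<open>s\<close> to the power -3/2 can
  then be summed by telescoping.\<close>

lemma inverse_sqrt_diff_ge:
  fixes s x :: real
  assumes "0 < x" "x < s"
  shows "x / (2 * (s * sqrt s)) \<le> 1 / sqrt (s - x) - 1 / sqrt s"
proof -
  define p r where "p = sqrt (s - x)" and "r = sqrt s"
  have p: "0 < p" "p \<le> r" "0 < r" using assms by (auto simp: p_def r_def)
  have x: "x = (r - p) * (r + p)" and s: "s = r * r"
    using assms by (auto simp: p_def r_def algebra_simps)
  have "x / (2 * (s * r)) \<le> x / ((r + p) * (p * r))"
  proof (rule divide_left_mono)
    have "(r + p) * (p * r) \<le> (2 * r) * (r * r)" using p by (intro mult_mono) auto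
    then show "(r + p) * (p * r) \<le> 2 * (s * r)" unfolding s by (simp add: mult.assoc)
  qed (use p assms s in \<open>auto intro!: mult_pos_pos add_pos_pos\<close>)
  also have "\<dots> = 1 / p - 1 / r"
    unfolding x using p by (simp add: divide_simps)
  finally show ?thesis by (simp add: p_def r_def)
qed

text \<open>The terms with \<open>real (Suc n) \<le> 1 / (b * x)\<close> equal \<open>b\<close> to
  the power 3/2, the others \<open>real (Suc n) * x\<close> to the power -3/2. Each group sums to at
  most the order of \<open>sqrt b / x\<close>.\<close>

lemma min_mult_sqrt_sums:
  fixes b x :: real
  assumes "0 < b" "0 < x"
  defines "t \<equiv> \<lambda>n. min b (1 / (real (Suc n) * x))"
  shows "summable (\<lambda>n. t n * sqrt (t n))" and "(\<Sum>n. t n * sqrt (t n)) \<le> 6 * sqrt b / x"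
proof -
  \<comment> \<open>\<open>min b (1/s) \<le> 2 / (1/b + s)\<close> turns the terms into ones dominated by differences of \<open>g\<close>.\<close>
  define g where "g n = 1 / sqrt (1/b + real n * x)" for n
  define c where "c = 4 * sqrt 2 / x"
  have le: "t n * sqrt (t n) \<le> c * (g n - g (Suc n))" for n
  proof -
    define s where "s = 1/b + real (Suc n) * x"
    have pos: "0 < 1/b" "0 < real n * x + x" "0 < real (Suc n) * x"
      using assms by (auto intro!: add_nonneg_pos)
    then have s: "x < s" "0 < s" using assms by (auto simp: s_def algebra_simps intro!: add_pos_nonneg)
    have t: "t n \<le> 2 / s"
    proof (cases "1/b \<le> real (Suc n) * x")
      case True
      then have "s \<le> 2 * (real (Suc n) * x)" unfolding s_def by linarith
      then have "2 / (2 * (real (Suc n) * x)) \<le> 2 / s" using s pos assms by (intro divide_left_mono mult_pos_pos) auto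
      then show ?thesis unfolding t_def by auto
    next
      case False
      then have "s \<le> 2 * (1 / b)" unfolding s_def by linarith
      then have "2 / (2 * (1 / b)) \<le> 2 / s" using s pos assms by (intro divide_left_mono mult_pos_pos) auto
      then show ?thesis unfolding t_def by auto
    qed
    have t0: "0 \<le> t n" unfolding t_def using assms pos by auto
    have "t n * sqrt (t n) \<le> (2 / s) * sqrt (2 / s)"
      using t t0 s by (intro mult_mono) auto
    also have "\<dots> = c * (x / (2 * (s * sqrt s)))"
      using assms s by (simp add: c_def real_sqrt_divide field_simps)
    also have "\<dots> \<le> c * (1 / sqrt (s - x) - 1 / sqrt s)"
      using inverse_sqrt_diff_ge[OF \<open>0 < x\<close> s(1)] assms by (intro mult_left_mono) (auto simp: c_def)
    also have "\<dots> = c * (g n - g (Suc n))"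
      by (simp add: g_def s_def algebra_simps)
    finally show ?thesis .
  qed
  have "filterlim (\<lambda>n. 1/b + real n * x) at_top sequentially"
    using assms by (intro filterlim_tendsto_add_at_top[OF tendsto_const] filterlim_at_top_mult_tendsto_pos[OF tendsto_const] filterlim_real_sequentially)
  then have "filterlim (\<lambda>n. sqrt (1/b + real n * x)) at_top sequentially"
    by (rule filterlim_compose[OF sqrt_at_top])
  then have "g \<longlonglongrightarrow> 0"
    unfolding g_def by (intro tendsto_divide_0[OF tendsto_const] filterlim_at_top_imp_at_infinity)
  then have sums: "(\<lambda>n. c * (g n - g (Suc n))) sums (c * (g 0 - 0))"
    by (intro sums_mult telescope_sums')
  have nonneg: "0 \<le> t n * sqrt (t n)" for n using assms by (auto simp: t_def)
  show 1: "summable (\<lambda>n. t n * sqrt (t n))"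
    using sums le nonneg by (intro summable_comparison_test'[OF sums_summable[OF sums]]) auto
  have "(\<Sum>n. t n * sqrt (t n)) \<le> c * (g 0 - 0)"
    using suminf_le[OF le 1 sums_summable[OF sums]] sums_unique[OF sums] by simp
  also have "\<dots> = (4 * sqrt 2) * sqrt b / x"
    using assms by (simp add: c_def g_def real_sqrt_divide)
  also have "4 * sqrt 2 \<le> (6::real)" 
    by (rule power2_le_imp_le) (auto simp: power_mult_distrib)
  then have "(4 * sqrt 2) * sqrt b / x \<le> 6 * sqrt b / x"
    using assms by (intro divide_right_mono mult_right_mono) auto
  finally show "(\<Sum>n. t n * sqrt (t n)) \<le> 6 * sqrt b / x" .
qed

lemma has_integral_inverse_sqrt:
  fixes b :: real
  assumes "0 \<le> b"
  shows "((\<lambda>t. 1 / sqrt t) has_integral 2 * sqrt b) {0..b}"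
proof -
  have "((\<lambda>t. 1 / sqrt t) has_integral (2 * sqrt b - 2 * sqrt 0)) {0..b}"
  proof (rule fundamental_theorem_of_calculus_interior)
    show "continuous_on {0..b} (\<lambda>t. 2 * sqrt t)" by (intro continuous_intros)
    fix t assume "t \<in> {0<..<b}"
    then show "((\<lambda>t. 2 * sqrt t) has_vector_derivative 1 / sqrt t) (at t)"
      unfolding has_real_derivative_iff_has_vector_derivative[symmetric]
      by (auto intro!: derivative_eq_intros simp: field_simps)
  qed (use assms in auto)
  then show ?thesis by simp
qed

text \<open>The jumps of \<open>K x\<close> accumulate only at 0. Hence the fundamental theorem with
  finitely many exceptional points applies on \<open>{e..1}\<close>, and \<open>{0..1}\<close> is
  reached only in the limit.\<close>

lemma finite_inverse_Ints:
  fixes x e :: real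
  assumes x: "0 < x" and "0 < e"
  shows "finite {y \<in> {e..1}. 1 / (x * y) \<in> \<int>}"
proof -
  have "{y \<in> {e..1}. 1 / (x * y) \<in> \<int>} \<subseteq> (\<lambda>k. 1 / (x * of_int k)) ` {0..\<lceil>1 / (x * e)\<rceil>}"
  proof
    fix y assume y: "y \<in> {y \<in> {e..1}. 1 / (x * y) \<in> \<int>}"
    then obtain k where k: "1 / (x * y) = of_int k" by (auto elim: Ints_cases)
    have pos: "0 < x * e" "x * e \<le> x * y" "0 < y" using y assms by auto
    then have "0 < 1 / (x * y)" "1 / (x * y) \<le> 1 / (x * e)" by (auto intro!: divide_left_mono mult_pos_pos simp: x)
    then have "0 \<le> k" "k \<le> \<lceil>1 / (x * e)\<rceil>" unfolding k by linarith+
    moreover have "y = 1 / (x * of_int k)" unfolding k[symmetric] using pos x by simp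
    ultimately show "y \<in> (\<lambda>k. 1 / (x * of_int k)) ` {0..\<lceil>1 / (x * e)\<rceil>}" by auto
  qed
  then show ?thesis by (rule finite_subset) simp
qed

subsection \<open>Integration by parts against the kernel\<close>

text \<open>The power 3/2 in the bound does three things: \<open>F y / (x * y)\<close> tends to 0 at
  0, the sum of \<open>F\<close> over the jump points of \<open>K x\<close> converges, and
  \<open>F t / t\<^sup>2\<close> is integrable at 0.\<close>

locale dominated_primitive =
  fixes x C :: real and F :: "real \<Rightarrow> real"
  assumes x: "0 < x" "x \<le> 1"
    and cont: "continuous_on {0..1} F"
    and dom: "\<And>y. y \<in> {0..1} \<Longrightarrow> \<bar>F y\<bar> \<le> C * (y * sqrt y)"
begin

definition a :: "nat \<Rightarrow> real" where "a n = 1 / (real (Suc n) * x)"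

text \<open>A primitive of \<open>\<lambda>y. K x y * F' y\<close>: the jumps of \<open>K x\<close> at the points \<open>a n\<close> are absorbed by
  the terms \<open>F (min y (a n))\<close>, so that \<open>H\<close> is continuous.\<close>

definition H :: "real \<Rightarrow> real" where
  "H y = (1/2 - 1 / (x * y)) * F y + (\<Sum>n. F (min y (a n))) - integral {0..y} (\<lambda>t. F t / t\<^sup>2) / x"

lemma a_pos: "0 < a n"
  using x by (simp add: a_def)

lemma C_nonneg: "0 \<le> C"
  using dom[of 1] by auto

lemma min_in: "y \<in> {0..1} \<Longrightarrow> min y (a n) \<in> {0..1}"
  using a_pos[of n] by auto

text \<open>Keeping \<open>b\<close> apart from \<open>y\<close> makes one bound serve twice: with
  \<open>b = y\<close> for the size of the sum, with \<open>b = 1\<close> as a uniform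
  majorant.\<close>

lemma abs_F_min_le:
  assumes "y \<in> {0..b}" "b \<le> 1"
  shows "\<bar>F (min y (a n))\<bar> \<le> C * (min b (a n) * sqrt (min b (a n)))"
proof -
  have "\<bar>F (min y (a n))\<bar> \<le> C * (min y (a n) * sqrt (min y (a n)))"
    using assms by (intro dom min_in) auto
  also have "\<dots> \<le> C * (min b (a n) * sqrt (min b (a n)))"
    using assms C_nonneg a_pos[of n] by (intro mult_left_mono mult_mono) auto
  finally show ?thesis .
qed

lemma summable_dom: "0 < b \<Longrightarrow> summable (\<lambda>n. C * (min b (a n) * sqrt (min b (a n))))"
  unfolding a_def using x by (intro summable_mult min_mult_sqrt_sums) auto

lemma summable_F_min:
  assumes "y \<in> {0..1}"
  shows "summable (\<lambda>n. F (min y (a n)))"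
proof (rule summable_comparison_test'[OF summable_dom[OF zero_less_one]])
  show "norm (F (min y (a n))) \<le> C * (min 1 (a n) * sqrt (min 1 (a n)))" for n
    using abs_F_min_le[of y 1 n] assms by simp
qed

lemma abs_sum_F_min_le:
  assumes "0 < b" "b \<le> 1"
  shows "\<bar>\<Sum>n. F (min b (a n))\<bar> \<le> 6 * C * sqrt b / x"
proof -
  have s: "summable (\<lambda>n. min b (a n) * sqrt (min b (a n)))"
    and le: "(\<Sum>n. min b (a n) * sqrt (min b (a n))) \<le> 6 * sqrt b / x"
    unfolding a_def using assms x min_mult_sqrt_sums[of b x] by auto
  have "norm (\<Sum>n. F (min b (a n))) \<le> (\<Sum>n. C * (min b (a n) * sqrt (min b (a n))))"
    using abs_F_min_le[of b b] assms by (intro norm_suminf_le summable_dom) auto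
  also have "\<dots> = C * (\<Sum>n. min b (a n) * sqrt (min b (a n)))"
    by (rule suminf_mult[OF s])
  also have "\<dots> \<le> C * (6 * sqrt b / x)" using le C_nonneg by (rule mult_left_mono)
  finally show ?thesis by (simp add: mult_ac)
qed

text \<open>The first \<open>m\<close> points \<open>a n\<close> lie at or to the right of
  \<open>y\<close>, all others at or to the left. Both bounds on \<open>1 / (x * y)\<close> may be
  attained, because at \<open>y = a m\<close> the two readings of the term
  \<open>F (min y (a m))\<close> coincide.\<close>

lemma sum_F_min_eq:
  assumes "0 < y" "y \<le> 1" "real m \<le> 1 / (x * y)" "1 / (x * y) \<le> real m + 1"
  shows "(\<Sum>n. F (min y (a n))) = real m * F y + (\<Sum>n. F (a (n + m)))"
    and "summable (\<lambda>n. F (a (n + m)))"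
proof -
  have 1: "min y (a n) = y" if "n < m" for n
  proof -
    have "real (Suc n) * (x * y) \<le> 1"
    proof -
      have "real (Suc n) \<le> 1 / (x * y)" using that assms by linarith
      then show ?thesis using assms x by (simp add: field_simps)
    qed
    then have "y \<le> a n" unfolding a_def using x by (subst pos_le_divide_eq) (auto simp: mult_ac)
    then show ?thesis by simp
  qed
  have 2: "min y (a (n + m)) = a (n + m)" for n
  proof -
    have "1 / (x * y) \<le> real (Suc (n + m))" using assms by linarith
    then have "1 \<le> y * (real (Suc (n + m)) * x)" using assms x by (simp add: field_simps)
    then have "a (n + m) \<le> y" unfolding a_def using x by (subst pos_divide_le_eq) auto
    then show ?thesis by simp
  qed
  have s: "summable (\<lambda>n. F (min y (a n)))" using assms by (intro summable_F_min) auto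
  have "summable (\<lambda>n. F (min y (a (n + m))))" using s by (subst summable_iff_shift)
  then show "summable (\<lambda>n. F (a (n + m)))" by (simp add: 2)
  have "(\<Sum>n. F (min y (a n))) = (\<Sum>n. F (min y (a (n + m)))) + (\<Sum>n<m. F (min y (a n)))"
    by (rule suminf_split_initial_segment[OF s])
  also have "(\<Sum>n<m. F (min y (a n))) = (\<Sum>n<m. F y)" by (intro sum.cong) (auto simp: 1)
  finally show "(\<Sum>n. F (min y (a n))) = real m * F y + (\<Sum>n. F (a (n + m)))" by (simp add: 2)
qed

lemma abs_F_div_le: "t \<in> {0..1} \<Longrightarrow> \<bar>F t / t\<^sup>2\<bar> \<le> C * (1 / sqrt t)"
proof -
  assume t: "t \<in> {0..1}"
  show ?thesis
  proof (cases "t = 0")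
    case False
    with t have "\<bar>F t / t\<^sup>2\<bar> \<le> C * (t * sqrt t) / t\<^sup>2"
      using dom[OF t] by (simp add: divide_right_mono)
    also have "\<dots> = C * (1 / sqrt t)"
      using t False by (simp add: power2_eq_square field_simps)
    finally show ?thesis .
  qed auto
qed

lemma F_div_integrable:
  assumes "b \<in> {0..1}"
  shows "(\<lambda>t. F t / t\<^sup>2) integrable_on {0..b}"
proof (rule measurable_bounded_by_integrable_imp_integrable_real)
  have "F \<in> borel_measurable (lebesgue_on {0..b})"
    using cont assms by (intro continuous_imp_measurable_on_sets_lebesgue) (auto intro: continuous_on_subset)
  then show "(\<lambda>t. F t / t\<^sup>2) \<in> borel_measurable (lebesgue_on {0..b})"
    by (intro borel_measurable_divide borel_measurable_power continuous_imp_measurable_on_sets_lebesgue[of _ "\<lambda>x. x"]) auto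
  show "(\<lambda>t. C * (1 / sqrt t)) integrable_on {0..b}"
    using has_integral_mult_right[OF has_integral_inverse_sqrt[of b]] assms by (auto simp: has_integral_iff)
qed (use assms abs_F_div_le in auto)

lemma abs_integral_F_div_le:
  assumes "b \<in> {0..1}"
  shows "\<bar>integral {0..b} (\<lambda>t. F t / t\<^sup>2)\<bar> \<le> 2 * C * sqrt b"
proof -
  have i: "((\<lambda>t. C * (1 / sqrt t)) has_integral C * (2 * sqrt b)) {0..b}"
    using assms by (intro has_integral_mult_right has_integral_inverse_sqrt) auto
  have "norm (integral {0..b} (\<lambda>t. F t / t\<^sup>2)) \<le> integral {0..b} (\<lambda>t. C * (1 / sqrt t))"
    using assms i by (intro integral_norm_bound_integral F_div_integrable abs_F_div_le[simplified real_norm_def[symmetric]])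
       (auto simp: has_integral_iff)
  then show ?thesis using i by (simp add: integral_unique mult_ac)
qed

text \<open>The three summands of \<open>H\<close> contribute 1, 6 and 2 times
  \<open>C * sqrt y / x\<close>.\<close>

lemma abs_H_le:
  assumes "0 < y" "y \<le> 1"
  shows "\<bar>H y\<bar> \<le> 9 * C * sqrt y / x"
proof -
  have xy: "0 < x * y" "x * y \<le> 1" using assms x by (auto intro: mult_le_one)
  then have "1 \<le> 1 / (x * y)" by (simp add: field_simps)
  then have "\<bar>1/2 - 1 / (x * y)\<bar> \<le> 1 / (x * y)" by linarith
  then have "\<bar>(1/2 - 1 / (x * y)) * F y\<bar> \<le> 1 / (x * y) * (C * (y * sqrt y))"
    unfolding abs_mult using dom[of y] assms xy by (intro mult_mono) auto
  also have "\<dots> = C * sqrt y / x" using assms x by (simp add: field_simps)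
  finally have 1: "\<bar>(1/2 - 1 / (x * y)) * F y\<bar> \<le> C * sqrt y / x" .
  have 2: "\<bar>\<Sum>n. F (min y (a n))\<bar> \<le> 6 * C * sqrt y / x" using assms by (rule abs_sum_F_min_le)
  have 3: "\<bar>integral {0..y} (\<lambda>t. F t / t\<^sup>2) / x\<bar> \<le> 2 * C * sqrt y / x"
    using abs_integral_F_div_le[of y] assms x by (simp add: divide_right_mono)
  have "9 * C * sqrt y / x = C * sqrt y / x + 6 * C * sqrt y / x + 2 * C * sqrt y / x"
    by (simp add: add_divide_distrib[symmetric])
  then show ?thesis unfolding H_def using 1 2 3 by linarith
qed

text \<open>Each \<open>F (min y (a n))\<close> is continuous and the series converges uniformly by
  the M-test. The point 0 is left out because of the coefficient \<open>1 / (x * y)\<close>.\<close>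

lemma continuous_on_H: "continuous_on {0<..1} H"
proof -
  have "continuous_on {0..1} (\<lambda>y. \<Sum>n. F (min y (a n)))"
  proof (rule uniform_limit_theorem)
    show "uniform_limit {0..1} (\<lambda>n y. \<Sum>i<n. F (min y (a i))) (\<lambda>y. \<Sum>n. F (min y (a n))) sequentially"
      using abs_F_min_le[of _ 1] summable_dom[of 1]
      by (intro Weierstrass_m_test[of _ _ "\<lambda>n. C * (min 1 (a n) * sqrt (min 1 (a n)))"]) auto
    show "\<forall>\<^sub>F n in sequentially. continuous_on {0..1} (\<lambda>y. \<Sum>i<n. F (min y (a i)))"
      using min_in by (intro always_eventually allI continuous_intros continuous_on_compose2[OF cont]) auto
  qed auto
  moreover have "continuous_on {0..1} (\<lambda>y. integral {0..y} (\<lambda>t. F t / t\<^sup>2))"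
    by (intro indefinite_integral_continuous_1 F_div_integrable) auto
  ultimately show ?thesis
    unfolding H_def[abs_def] using x
    by (intro continuous_intros) (auto intro: continuous_on_subset[OF cont] continuous_on_subset)
qed

lemma H_eq:
  assumes "0 < y" "y \<le> 1" "real m \<le> 1 / (x * y)" "1 / (x * y) \<le> real m + 1"
  shows "H y = (1/2 + real m - 1 / (x * y)) * F y + (\<Sum>n. F (a (n + m))) - integral {0..y} (\<lambda>t. F t / t\<^sup>2) / x"
  unfolding H_def sum_F_min_eq(1)[OF assms] by (simp add: algebra_simps)

text \<open>Between two jumps the sum varies only through \<open>real m * F y\<close>. Besides
  \<open>K x y * f\<close>, the product rule leaves \<open>F y / (x * y\<^sup>2)\<close>, which the
  integral term of \<open>H\<close> cancels.\<close>

lemma H_has_derivative: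
  assumes y: "0 < y" "y < 1" "1 / (x * y) \<notin> \<int>" and F': "(F has_real_derivative f) (at y)"
  shows "(H has_real_derivative K x y * f) (at y)"
proof -
  define m where "m = nat \<lfloor>1 / (x * y)\<rfloor>"
  have pos: "0 < x * y" using x y by simp
  have m: "real m < 1 / (x * y)" "1 / (x * y) < real m + 1"
  proof -
    have "real m = of_int \<lfloor>1 / (x * y)\<rfloor>" using pos by (simp add: m_def)
    moreover have "of_int \<lfloor>1 / (x * y)\<rfloor> \<noteq> 1 / (x * y)" using y(3) by (metis Ints_of_int)
    ultimately show "real m < 1 / (x * y)" "1 / (x * y) < real m + 1" by linarith+
  qed
  define G where "G y = (1/2 + real m - 1 / (x * y)) * F y + (\<Sum>n. F (a (n + m))) - integral {0..y} (\<lambda>t. F t / t\<^sup>2) / x" for y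
  have c: "isCont (\<lambda>t. F t / t\<^sup>2) y"
    using y DERIV_isCont[OF F'] by (intro continuous_intros) auto
  have "((\<lambda>u. integral {0..u} (\<lambda>t. F t / t\<^sup>2)) has_vector_derivative F y / y\<^sup>2) (at y within ({0..1} - {}))"
    using y c by (intro integral_has_vector_derivative_continuous_at F_div_integrable)
       (auto intro: continuous_at_imp_continuous_at_within)
  then have "((\<lambda>u. integral {0..u} (\<lambda>t. F t / t\<^sup>2)) has_real_derivative F y / y\<^sup>2) (at y within {0..1})"
    by (simp add: has_real_derivative_iff_has_vector_derivative)
  then have I: "((\<lambda>u. integral {0..u} (\<lambda>t. F t / t\<^sup>2)) has_real_derivative F y / y\<^sup>2) (at y)"
    using y at_within_interior[of y "{0..1}"] by (simp add: interior_atLeastAtMost_real)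
  have "((\<lambda>y. 1/2 + real m - 1 / (x * y)) has_real_derivative 1 / (x * y\<^sup>2)) (at y)"
    using x y(1,2) by (auto intro!: derivative_eq_intros simp: power2_eq_square)
  then have "(G has_real_derivative
      1 / (x * y\<^sup>2) * F y + f * (1/2 + real m - 1 / (x * y)) + 0 - F y / y\<^sup>2 / x) (at y)"
    unfolding G_def[abs_def] by (intro DERIV_add DERIV_diff DERIV_mult F' DERIV_const DERIV_cdivide I)
  then have G': "(G has_real_derivative (1/2 + real m - 1 / (x * y)) * f) (at y)"
    by (simp add: mult.commute)
  have "K x y = 1/2 + real m - 1 / (x * y)" using x y m by (intro K_eq) auto
  \<comment> \<open>\<open>G\<close> is \<open>H\<close> with \<open>m\<close> frozen; the two agree
    on the open set where \<open>m\<close> stays the integer part of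
    \<open>1 / (x * y)\<close>.\<close>
  moreover have "(H has_real_derivative (1/2 + real m - 1 / (x * y)) * f) (at y)"
  proof (rule has_field_derivative_transform_within_open[OF G'])
    have "continuous_on {0<..<1} (\<lambda>y. 1 / (x * y))" using x by (intro continuous_intros) auto
    then show "open ({0<..<1} \<inter> (\<lambda>y. 1 / (x * y)) -` {real m <..< real m + 1})"
      by (rule continuous_open_preimage) auto
    show "y \<in> {0<..<1} \<inter> (\<lambda>y. 1 / (x * y)) -` {real m <..< real m + 1}" using y m by auto
    fix z assume "z \<in> {0<..<1} \<inter> (\<lambda>y. 1 / (x * y)) -` {real m <..< real m + 1}"
    then show "G z = H z" unfolding G_def by (subst H_eq[of z m]) auto
  qed
  ultimately show ?thesis by simp
qed

text \<open>\<open>S\<close> collects the points where \<open>F\<close> may fail to be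
  differentiable. Together with the jumps of \<open>K x\<close> it is finite on
  \<open>{e..1}\<close>, and the continuity of \<open>H\<close> bridges both kinds of
  points.\<close>

lemma has_integral_K_mult:
  assumes e: "0 < e" "e \<le> b" "b \<le> 1" and S: "finite (S \<inter> {e..1})"
    and F': "\<And>y. 0 < y \<Longrightarrow> y < 1 \<Longrightarrow> y \<notin> S \<Longrightarrow> (F has_real_derivative f y) (at y)"
  shows "((\<lambda>y. K x y * f y) has_integral H b - H e) {e..b}"
proof (rule fundamental_theorem_of_calculus_interior_strong)
  show "finite (S \<inter> {e..1} \<union> {y \<in> {e..1}. 1 / (x * y) \<in> \<int>})"
    using S finite_inverse_Ints[of x e] x e by auto
  show "continuous_on {e..b} H" using continuous_on_H by (rule continuous_on_subset) (use e in auto)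
  fix y assume "y \<in> {e<..<b} - (S \<inter> {e..1} \<union> {y \<in> {e..1}. 1 / (x * y) \<in> \<int>})"
  then show "(H has_vector_derivative K x y * f y) (at y)"
    unfolding has_real_derivative_iff_has_vector_derivative[symmetric]
    using e by (intro H_has_derivative F') auto
qed (use e in auto)

lemma tendsto_H_0: "(H \<longlongrightarrow> 0) (at_right 0)"
proof (rule Lim_null_comparison)
  show "\<forall>\<^sub>F y in at_right 0. norm (H y) \<le> 9 * C * sqrt y / x"
    using eventually_at_right_real[OF zero_less_one] by (rule eventually_mono) (use abs_H_le in auto)
  have "((\<lambda>y. 9 * C * sqrt y / x) \<longlongrightarrow> 9 * C * sqrt 0 / x) (at_right 0)"
    using x by (intro tendsto_intros) auto
  then show "((\<lambda>y. 9 * C * sqrt y / x) \<longlongrightarrow> 0) (at_right 0)" by simp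
qed

text \<open>Let \<open>e\<close> tend to 0, where \<open>H e\<close> vanishes. Integrability up to 0
  is a separate assumption, since the bound on \<open>F\<close> does not control \<open>f\<close>
  there.\<close>

lemma integral_K_mult:
  assumes S: "\<And>e. 0 < e \<Longrightarrow> finite (S \<inter> {e..1})"
    and F': "\<And>y. 0 < y \<Longrightarrow> y < 1 \<Longrightarrow> y \<notin> S \<Longrightarrow> (F has_real_derivative f y) (at y)"
    and int: "(\<lambda>y. K x y * f y) integrable_on {0..1}"
  shows "integral {0..1} (\<lambda>y. K x y * f y) = H 1"
proof -
  let ?g = "\<lambda>y. K x y * f y"
  have "continuous_on {0..1} (\<lambda>e. integral {e..1} ?g)"
    by (rule indefinite_integral_continuous_1'[OF int])
  then have "((\<lambda>e. integral {e..1} ?g) \<longlongrightarrow> integral {0..1} ?g) (at 0 within {0..1})"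
    by (auto simp: continuous_on)
  then have 1: "((\<lambda>e. integral {e..1} ?g) \<longlongrightarrow> integral {0..1} ?g) (at_right 0)"
    by (simp add: at_within_Icc_at_right)
  have "((\<lambda>e. H 1 - H e) \<longlongrightarrow> H 1 - 0) (at_right 0)" by (intro tendsto_intros tendsto_H_0)
  moreover have "\<forall>\<^sub>F e in at_right 0. H 1 - H e = integral {e..1} ?g"
    using eventually_at_right_real[OF zero_less_one]
  proof (eventually_elim)
    case (elim e)
    then show ?case using has_integral_K_mult[of e 1 S f] S F' by (auto simp: has_integral_iff)
  qed
  ultimately have "((\<lambda>e. integral {e..1} ?g) \<longlongrightarrow> H 1 - 0) (at_right 0)"
    by (rule Lim_transform_eventually)
  from tendsto_unique[OF _ 1 this] show ?thesis by simp
qed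

end

subsection \<open>The iterated kernel\<close>

text \<open>This is 1/12 minus half the periodic second Bernoulli polynomial, the constant making it
  vanish at the integers. It is a continuous primitive of the sawtooth
  \<open>1/2 - frac t\<close>.\<close>

definition bern :: "real \<Rightarrow> real" where "bern t = frac t * (1 - frac t) / 2"

lemma bern_bounds: "0 \<le> bern t" "bern t \<le> 1/8"
proof -
  show "0 \<le> bern t" using frac_lt_1[of t] by (simp add: bern_def)
  have "0 \<le> (frac t - 1/2)\<^sup>2" by simp
  then show "bern t \<le> 1/8" by (simp add: bern_def power2_eq_square field_simps)
qed

text \<open>By the symmetry of \<open>u * (1 - u)\<close> about 1/2, a single formula covers both
  sides of an integer, which gives continuity there.\<close>

lemma bern_eq_near_int:
  fixes t :: real
  assumes "\<bar>t - of_int k\<bar> < 1"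
  shows "bern t = \<bar>t - of_int k\<bar> * (1 - \<bar>t - of_int k\<bar>) / 2"
proof (cases "of_int k \<le> t")
  case True
  then have "\<lfloor>t\<rfloor> = k" using assms by (intro floor_unique) auto
  then show ?thesis using True by (simp add: bern_def frac_def)
next
  case False
  then have "\<lfloor>t\<rfloor> = k - 1" using assms by (intro floor_unique) auto
  then have "frac t = 1 - (of_int k - t)" "\<bar>t - of_int k\<bar> = of_int k - t"
    using False by (auto simp: frac_def)
  then show ?thesis by (simp only: bern_def) (simp add: algebra_simps)
qed

lemma isCont_bern: "isCont bern t"
proof (cases "t \<in> \<int>")
  case False
  then show ?thesis unfolding bern_def by (intro continuous_intros continuous_frac) auto
next
  case True
  then obtain k where k: "t = of_int k" by (auto elim: Ints_cases)
  have "isCont (\<lambda>s. \<bar>s - of_int k\<bar> * (1 - \<bar>s - of_int k\<bar>) / 2) t" by (intro continuous_intros) auto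
  moreover have ev: "\<forall>\<^sub>F s in nhds t. bern s = \<bar>s - of_int k\<bar> * (1 - \<bar>s - of_int k\<bar>) / 2"
  proof (rule eventually_nhds_in_open[THEN eventually_mono])
    show "open (ball t 1)" "t \<in> ball t 1" by auto
    show "s \<in> ball t 1 \<Longrightarrow> bern s = \<bar>s - of_int k\<bar> * (1 - \<bar>s - of_int k\<bar>) / 2" for s
      by (intro bern_eq_near_int) (auto simp: k dist_real_def)
  qed
  ultimately show ?thesis by (simp add: isCont_cong[OF ev])
qed

lemma has_derivative_frac:
  fixes t :: real
  assumes "t \<notin> \<int>"
  shows "(frac has_real_derivative 1) (at t)"
proof -
  have "((\<lambda>t. t - of_int \<lfloor>t\<rfloor>) has_real_derivative (1 - 0)) (at t)"
    using assms by (intro DERIV_diff DERIV_ident floor_has_real_derivative) auto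
  then show ?thesis by (simp add: frac_def[abs_def])
qed

lemma has_derivative_bern:
  assumes "t \<notin> \<int>"
  shows "(bern has_real_derivative (1/2 - frac t)) (at t)"
proof -
  note f = has_derivative_frac[OF assms]
  have "((\<lambda>t. frac t * (1 - frac t) / 2) has_real_derivative
      (1 * (1 - frac t) + (0 - 1) * frac t) / 2) (at t)"
    by (intro DERIV_cdivide DERIV_mult DERIV_diff DERIV_const f)
  then show ?thesis by (simp add: bern_def[abs_def] field_simps)
qed

lemma borel_measurable_K: "(\<lambda>(x, y). K x y) \<in> borel_measurable (borel \<Otimes>\<^sub>M borel)"
  unfolding K_def[abs_def] frac_def split_def by measurable

lemma measurable_ident_lebesgue_on: "(\<lambda>x. x) \<in> borel_measurable (lebesgue_on {0..1::real})"
  by (intro continuous_imp_measurable_on_sets_lebesgue) auto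

lemma borel_measurable_K_right: "(\<lambda>y. K x y) \<in> borel_measurable (lebesgue_on {0..1})"
proof -
  have "(\<lambda>y::real. (x, y)) \<in> lebesgue_on {0..1} \<rightarrow>\<^sub>M borel \<Otimes>\<^sub>M borel"
    using measurable_Pair[of "\<lambda>_. x" "lebesgue_on {0..1}" borel "\<lambda>y::real. y" borel]
      measurable_ident_lebesgue_on by simp
  from measurable_compose[OF this borel_measurable_K] show ?thesis by simp
qed

lemma integrable_bounded_Icc:
  fixes f :: "real \<Rightarrow> real"
  assumes "f \<in> borel_measurable (lebesgue_on {0..1})" "\<And>y. y \<in> {0..1} \<Longrightarrow> \<bar>f y\<bar> \<le> B"
  shows "integrable (lebesgue_on {0..1}) f" "f integrable_on {0..1}"
proof -
  show "integrable (lebesgue_on {0..1}) f"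
  proof (rule measurable_bounded_by_integrable_imp_lebesgue_integrable[OF assms(1)])
    show "integrable (lebesgue_on {0..1::real}) (\<lambda>_. B)" by (intro finite_measure.integrable_const finite_measure_lebesgue_on) simp
    show "norm (f y) \<le> B" if "y \<in> {0..1}" for y using assms(2)[OF that] by simp
  qed simp
  then show "f integrable_on {0..1}" by (intro integrable_on_lebesgue_on) auto
qed

lemma integrable_K_mult:
  assumes "f \<in> borel_measurable (lebesgue_on {0..1})" "\<And>y. y \<in> {0..1} \<Longrightarrow> \<bar>f y\<bar> \<le> B"
  shows "integrable (lebesgue_on {0..1}) (\<lambda>y. K x y * f y)" "(\<lambda>y. K x y * f y) integrable_on {0..1}"
proof -
  have m: "(\<lambda>y. K x y * f y) \<in> borel_measurable (lebesgue_on {0..1})"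
    using assms borel_measurable_K_right by (intro borel_measurable_times)
  have b: "\<And>y. y \<in> {0..1} \<Longrightarrow> \<bar>K x y * f y\<bar> \<le> 1/2 * B"
    unfolding abs_mult using abs_K_le assms(2) by (intro mult_mono) auto
  show "integrable (lebesgue_on {0..1}) (\<lambda>y. K x y * f y)" "(\<lambda>y. K x y * f y) integrable_on {0..1}"
    by (rule integrable_bounded_Icc[OF m b], assumption)+
qed

lemma abs_integral_K_K_le:
  assumes x: "0 < x" "x \<le> 1" and z: "0 < z" "z \<le> 1"
  shows "\<bar>integral {0..1} (\<lambda>y. K z y * K x y)\<bar> \<le> 2 * x / z"
proof -
  \<comment> \<open>\<open>W\<close> is a small primitive of \<open>K x\<close>, up to the small error \<open>V\<close>.\<close>
  define W where "W y = - x * y\<^sup>2 * bern (1 / (x * y))" for y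
  define V where "V y = 2 * x * y * bern (1 / (x * y))" for y
  have cb: "continuous_on {0<..} (\<lambda>y. bern (1 / (x * y)))"
  proof (rule continuous_on_compose2[where g = bern and t = UNIV])
    show "continuous_on UNIV bern" by (simp add: continuous_on_eq_continuous_at isCont_bern)
    show "continuous_on {0<..} (\<lambda>y. 1 / (x * y))" using x by (intro continuous_intros) auto
  qed auto
  have W_le: "\<bar>W y\<bar> \<le> x / 8 * (y * y)" for y
  proof -
    have "\<bar>W y\<bar> = (x * (y * y)) * bern (1 / (x * y))"
      using x bern_bounds(1) by (simp add: W_def abs_mult power2_eq_square)
    also have "\<dots> \<le> (x * (y * y)) * (1/8)"
      using x bern_bounds by (intro mult_left_mono) auto
    finally show ?thesis by simp
  qed
  interpret P: dominated_primitive z "x / 8" W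
  proof
    show "\<bar>W y\<bar> \<le> x / 8 * (y * sqrt y)" if y: "y \<in> {0..1}" for y
    proof -
      \<comment> \<open>The quadratic decay of \<open>W\<close> is weakened to the power 3/2 that
        the locale asks for.\<close>
      have "y \<le> sqrt y" using y by (intro real_le_rsqrt) (auto simp: power2_eq_square mult_left_le)
      then have "x / 8 * (y * y) \<le> x / 8 * (y * sqrt y)" using x y by (intro mult_left_mono) auto
      with W_le[of y] show ?thesis by linarith
    qed
    have W0: "isCont W 0"
    proof -
      have "(W \<longlongrightarrow> 0) (at 0)"
      proof (rule Lim_null_comparison)
        show "\<forall>\<^sub>F y in at 0. norm (W y) \<le> x / 8 * (y * y)" using W_le by simp
        have "((\<lambda>y. x / 8 * (y * y)) \<longlongrightarrow> x / 8 * (0 * 0)) (at 0)" by (intro tendsto_intros)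
        then show "((\<lambda>y. x / 8 * (y * y)) \<longlongrightarrow> 0) (at 0)" by simp
      qed
      then show ?thesis by (simp add: isCont_def W_def)
    qed
    have "continuous_on {0<..} W" unfolding W_def[abs_def] by (intro continuous_intros cb)
    then have "isCont W y" if "0 < y" for y
      using that by (simp add: continuous_on_eq_continuous_at)
    with W0 have "isCont W y" if "0 \<le> y" for y using that by (cases "y = 0") auto
    then show "continuous_on {0..1} W" by (auto intro: continuous_at_imp_continuous_on)
  qed (use z in auto)
  have V_le: "\<bar>V y\<bar> \<le> x / 4" if "y \<in> {0..1}" for y
  proof -
    have "\<bar>V y\<bar> = (2 * x * y) * bern (1 / (x * y))"
      using x that bern_bounds(1) by (simp add: V_def abs_mult)
    also have "\<dots> \<le> (2 * x * 1) * (1/8)"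
      using x that bern_bounds by (intro mult_mono) auto
    finally show ?thesis by simp
  qed
  have bern_meas: "bern \<in> borel_measurable borel"
    by (intro borel_measurable_continuous_onI) (auto simp: continuous_on_eq_continuous_at isCont_bern)
  have V_meas: "V \<in> borel_measurable (lebesgue_on {0..1})"
  proof -
    have "(\<lambda>y. 1 / (x * y)) \<in> borel_measurable (lebesgue_on {0..1})"
      by (intro borel_measurable_times borel_measurable_const measurable_ident_lebesgue_on
          borel_measurable_divide)
    from measurable_compose[OF this bern_meas] show ?thesis
      unfolding V_def[abs_def]
      by (intro borel_measurable_times borel_measurable_const measurable_ident_lebesgue_on)
  qed
  note iK = integrable_K_mult(2)[OF borel_measurable_K_right abs_K_le, of z x]
  note iV = integrable_K_mult(2)[OF V_meas V_le, of z]
  \<comment> \<open>The inner derivative \<open>- 1 / (x * y\<^sup>2)\<close> cancels the factor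
    \<open>- x * y\<^sup>2\<close> and leaves \<open>K x y\<close>; differentiating that factor
    instead gives \<open>- V y\<close>.\<close>
  have W': "(W has_real_derivative K x y - V y) (at y)" if y: "0 < y" "1 / (x * y) \<notin> \<int>" for y
  proof -
    have inv: "((\<lambda>y. 1 / (x * y)) has_real_derivative - 1 / (x * y\<^sup>2)) (at y)"
      using x y by (intro DERIV_inverse_mult) auto
    have b: "((\<lambda>y. bern (1 / (x * y))) has_real_derivative (1/2 - frac (1 / (x * y))) * (- 1 / (x * y\<^sup>2))) (at y)"
      by (rule DERIV_chain2[OF has_derivative_bern[OF y(2)] inv])
    have sq: "((\<lambda>y. - x * y\<^sup>2) has_real_derivative - x * (2 * y)) (at y)"
      by (auto intro!: derivative_eq_intros)
    have "(W has_real_derivative - x * (2 * y) * bern (1 / (x * y)) +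
       (1/2 - frac (1 / (x * y))) * (- 1 / (x * y\<^sup>2)) * (- x * y\<^sup>2)) (at y)"
      unfolding W_def[abs_def] by (rule DERIV_mult[OF sq b])
    moreover have "(1/2 - frac (1 / (x * y))) * (- 1 / (x * y\<^sup>2)) * (- x * y\<^sup>2) = K x y"
      using x y by (simp add: K_def)
    ultimately show ?thesis by (simp add: V_def algebra_simps)
  qed
  have "integral {0..1} (\<lambda>y. K z y * (K x y - V y)) = P.H 1"
  proof (rule P.integral_K_mult)
    show "finite ({y. 1 / (x * y) \<in> \<int>} \<inter> {e..1})" if "0 < e" for e
      using finite_inverse_Ints[OF x(1) that] by (simp add: Int_def conj_commute)
    show "(\<lambda>y. K z y * (K x y - V y)) integrable_on {0..1}"
      using integrable_diff[OF iK iV] by (simp add: algebra_simps)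
  qed (use W' in auto)
  moreover have "integral {0..1} (\<lambda>y. K z y * (K x y - V y)) =
      integral {0..1} (\<lambda>y. K z y * K x y) - integral {0..1} (\<lambda>y. K z y * V y)"
    using integral_diff[OF iK iV] by (simp add: algebra_simps)
  moreover have "\<bar>P.H 1\<bar> \<le> 9/8 * (x / z)" using P.abs_H_le[of 1] by simp
  moreover have "\<bar>integral {0..1} (\<lambda>y. K z y * V y)\<bar> \<le> x / 8"
  proof -
    have "norm (integral {0..1} (\<lambda>y. K z y * V y)) \<le> integral {0..1} (\<lambda>y::real. x / 8)"
    proof (rule integral_norm_bound_integral[OF iV])
      show "norm (K z y * V y) \<le> x / 8" if "y \<in> {0..1}" for y
        using mult_mono[OF abs_K_le[of z y] V_le[OF that]] by (simp add: abs_mult)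
    qed auto
    then show ?thesis by simp
  qed
  \<comment> \<open>This brings the error from \<open>V\<close> to the scale \<open>x / z\<close>;
    the coefficients 9/8 and 1/8 then add up to less than 2.\<close>
  moreover have "x \<le> x / z" using x z by (simp add: field_simps)
  moreover have "2 * x / z = 2 * (x / z)" by simp
  ultimately show ?thesis by linarith
qed

subsection \<open>Eigenfunctions\<close>

lemma continuous_on_of_decay:
  fixes g :: "real \<Rightarrow> real"
  assumes pos: "continuous_on {0<..1} g" and decay: "\<And>y. y \<in> {0..1} \<Longrightarrow> \<bar>g y\<bar> \<le> C * sqrt y"
  shows "continuous_on {0..1} g"
proof -
  have g0: "g 0 = 0" using decay[of 0] by simp
  have "(g \<longlongrightarrow> g 0) (at 0 within {0..1})"
    unfolding g0
  proof (rule Lim_null_comparison)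
    show "\<forall>\<^sub>F y in at 0 within {0..1}. norm (g y) \<le> C * sqrt y"
      using decay by (auto simp: eventually_at_filter)
    have "((\<lambda>y. C * sqrt y) \<longlongrightarrow> C * sqrt 0) (at 0 within {0..1})" by (intro tendsto_intros)
    then show "((\<lambda>y. C * sqrt y) \<longlongrightarrow> 0) (at 0 within {0..1})" by simp
  qed
  moreover have "(g \<longlongrightarrow> g y) (at y within {0..1})" if y: "y \<in> {0<..1}" for y
  proof -
    have "at y within {0<..1} = at y within {0..1}"
      using y by (intro at_within_nhd[of _ "{0<..}"]) auto
    with pos y show ?thesis by (metis continuous_on)
  qed
  ultimately show ?thesis
    unfolding continuous_on by (metis atLeastAtMost_iff greaterThanAtMost_iff less_eq_real_def)
qed

text \<open>"Left" refers to the first argument of \<open>K\<close>; the continuity is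
  two-sided.\<close>

lemma isCont_K_left:
  assumes "0 < x" "0 < y" "1 / (x * y) \<notin> \<int>"
  shows "isCont (\<lambda>x. K x y) x"
proof -
  have "isCont (\<lambda>x. 1 / (x * y)) x" using assms by (intro continuous_intros) auto
  then have c: "isCont (\<lambda>x. 1/2 - frac (1 / (x * y))) x"
    using assms isCont_o2[of x "\<lambda>x. 1 / (x * y)" frac] continuous_frac by (intro continuous_intros) auto
  have ev: "\<forall>\<^sub>F u in nhds x. K u y = 1/2 - frac (1 / (u * y))"
  proof (rule eventually_nhds_in_open[THEN eventually_mono])
    show "open {0::real<..}" "x \<in> {0<..}" using assms by auto
  qed (use assms in \<open>auto simp: K_def\<close>)
  show ?thesis using c by (simp add: isCont_cong[OF ev])
qed

text \<open>The exceptional set is countable. It contains \<open>y = 0\<close>, where the quotient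
  is 0 by convention, so the lemma also yields \<open>y \<noteq> 0\<close> almost
  everywhere.\<close>

lemma AE_not_inverse_Ints:
  fixes x :: real
  assumes "0 < x"
  shows "AE y in lebesgue_on {0..1}. 1 / (x * y) \<notin> \<int>"
proof -
  have "{y. 1 / (x * y) \<in> \<int>} \<subseteq> range (\<lambda>k. 1 / (x * of_int k))"
  proof
    fix y assume "y \<in> {y. 1 / (x * y) \<in> \<int>}"
    then obtain k where "1 / (x * y) = of_int k" by (auto elim: Ints_cases)
    then have "y = 1 / (x * of_int k)" using assms by (metis divide_divide_eq_right mult.commute nonzero_mult_div_cancel_right mult_1 divide_divide_eq_left less_irrefl)
    then show "y \<in> range (\<lambda>k. 1 / (x * of_int k))" by auto
  qed
  then have "countable {y. 1 / (x * y) \<in> \<int>}" by (rule countable_subset) auto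
  then have "{y. 1 / (x * y) \<in> \<int>} \<in> null_sets lebesgue"
    by (intro null_sets_completionI countable_imp_null_set_lborel)
  then have "AE y in lebesgue. y \<notin> {y. 1 / (x * y) \<in> \<int>}" by (rule AE_not_in)
  then show ?thesis by (subst AE_restrict_space_iff) (auto elim: AE_mp)
qed

lemma inverse_floor_bounds:
  fixes x :: real
  assumes "0 < x" "x \<le> 1"
  obtains m :: nat where "1 \<le> m" "real m \<le> 1 / x" "1 / x < real m + 1"
proof
  have "1 \<le> 1 / x" using assms by simp
  then have "1 \<le> \<lfloor>1 / x\<rfloor>" by (simp add: le_floor_iff)
  then show "1 \<le> nat \<lfloor>1 / x\<rfloor>" "real (nat \<lfloor>1 / x\<rfloor>) \<le> 1 / x" "1 / x < real (nat \<lfloor>1 / x\<rfloor>) + 1"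
    by (auto simp: nat_le_iff) linarith+
qed

lemma finite_inverse_Ints_1: "0 < e \<Longrightarrow> finite ({y. 1 / y \<in> \<int>} \<inter> {e..1::real})"
  using finite_inverse_Ints[of 1 e] by (simp add: Int_def conj_commute)

section \<open>Bounds and continuity of an eigenfunction\<close>

locale K_eigenfunction =
  fixes phi :: "real \<Rightarrow> real" and lam :: real
  assumes eig: "eigenfunction phi lam"
begin

lemma phi_measurable: "phi \<in> borel_measurable (lebesgue_on {0..1})"
  using eig by (simp add: eigenfunction_def L2_01_def)

lemma phi_eq_lebesgue: "x \<in> {0..1} \<Longrightarrow> phi x = lam * (\<integral>y. K x y * phi y \<partial>lebesgue_on {0..1})"
  using eig by (simp add: eigenfunction_def)

lemma phi_integrable: "integrable (lebesgue_on {0..1}) phi"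
proof (rule measurable_bounded_by_integrable_imp_lebesgue_integrable[OF phi_measurable])
  have "integrable (lebesgue_on {0..1}) (\<lambda>x. (phi x)\<^sup>2)"
    using eig by (simp add: eigenfunction_def L2_01_def)
  then show "integrable (lebesgue_on {0..1}) (\<lambda>x. 1 + (phi x)\<^sup>2)"
    by (intro Bochner_Integration.integrable_add finite_measure.integrable_const finite_measure_lebesgue_on) simp_all
  show "norm (phi x) \<le> 1 + (phi x)\<^sup>2" for x
  proof -
    have "0 \<le> (\<bar>phi x\<bar> - 1/2)\<^sup>2" by simp
    then show ?thesis by (simp add: power2_diff power_divide)
  qed
qed simp

text \<open>A bound for \<open>\<bar>phi x\<bar>\<close> on \<open>{0..1}\<close>, obtained from the
  eigenvalue equation with the kernel bounded by 1.\<close>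

definition M :: real where "M = \<bar>lam\<bar> * (\<integral>y. \<bar>phi y\<bar> \<partial>lebesgue_on {0..1})"

lemma M_nonneg: "0 \<le> M"
  by (simp add: M_def)

lemma abs_phi_le_M:
  assumes "x \<in> {0..1}"
  shows "\<bar>phi x\<bar> \<le> M"
proof -
  have int: "integrable (lebesgue_on {0..1}) (\<lambda>y. \<bar>phi y\<bar>)" using phi_integrable by simp
  have le: "\<bar>K x y * phi y\<bar> \<le> \<bar>phi y\<bar>" for y
    unfolding abs_mult using abs_K_le[of x y] by (intro mult_left_le_one_le) auto
  have "integrable (lebesgue_on {0..1}) (\<lambda>y. K x y * phi y)"
    using le by (intro measurable_bounded_by_integrable_imp_lebesgue_integrable[OF _ int]
        borel_measurable_times borel_measurable_K_right phi_measurable) auto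
  then have "\<bar>\<integral>y. K x y * phi y \<partial>lebesgue_on {0..1}\<bar> \<le> (\<integral>y. \<bar>phi y\<bar> \<partial>lebesgue_on {0..1})"
    using int le by (intro order_trans[OF integral_abs_bound] integral_mono) auto
  then show ?thesis
    unfolding phi_eq_lebesgue[OF assms] M_def abs_mult by (intro mult_left_mono) auto
qed

lemma K_phi_integrable_on: "(\<lambda>y. K x y * phi y) integrable_on {0..1}"
  by (rule integrable_K_mult(2)[OF phi_measurable abs_phi_le_M])

lemma phi_eq: "x \<in> {0..1} \<Longrightarrow> phi x = lam * integral {0..1} (\<lambda>y. K x y * phi y)"
  using lebesgue_integral_eq_integral[OF integrable_K_mult(1)[OF phi_measurable abs_phi_le_M]]
    phi_eq_lebesgue by simp

text \<open>The factor \<open>lam\<^sup>2\<close> comes from using the eigenvalue equation twice,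
  \<open>sqrt 2\<close> from the iterated kernel, and 2 from the integral of
  \<open>1 / sqrt z\<close>.\<close>

definition C :: real where "C = lam\<^sup>2 * (M * (2 * sqrt 2))"

lemma C_nonneg: "0 \<le> C"
  using M_nonneg by (simp add: C_def)

text \<open>Inserting the eigenvalue equation into itself and exchanging the integrals expresses
  \<open>phi x\<close> as \<open>lam\<^sup>2\<close> times the integral of
  \<open>phi z * k z\<close>, where \<open>k\<close> is the iterated kernel and is small for small
  \<open>x\<close>.\<close>

lemma abs_phi_le:
  assumes "x \<in> {0..1}"
  shows "\<bar>phi x\<bar> \<le> C * sqrt x"
proof (cases "x = 0")
  case True
  then show ?thesis using phi_eq[of 0] by (simp add: K_def)
next
  case False
  with assms have x: "0 < x" "x \<le> 1" by auto
  let ?L = "lebesgue_on {0..1::real}"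
  interpret L: finite_measure ?L by (rule finite_measure_lebesgue_on) simp
  interpret LL: pair_sigma_finite ?L ?L ..
  interpret LF: finite_measure "?L \<Otimes>\<^sub>M ?L"
    by (rule finite_measure_pair_measure) (rule L.finite_measure_axioms)+
  define f where "f y z = K x y * (K y z * phi z)" for y z
  define k where "k z = integral {0..1} (\<lambda>y. K z y * K x y)" for z
  have id: "(\<lambda>y::real. y) \<in> ?L \<rightarrow>\<^sub>M borel" by (rule measurable_ident_lebesgue_on)
  have 1: "(\<lambda>p. fst p) \<in> ?L \<Otimes>\<^sub>M ?L \<rightarrow>\<^sub>M borel" "(\<lambda>p. snd p) \<in> ?L \<Otimes>\<^sub>M ?L \<rightarrow>\<^sub>M borel"
    by (rule measurable_compose[OF measurable_fst id], rule measurable_compose[OF measurable_snd id])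
  have "(\<lambda>p. K (fst p) (snd p)) \<in> borel_measurable (?L \<Otimes>\<^sub>M ?L)"
    using measurable_compose[OF measurable_Pair[OF 1] borel_measurable_K] by simp
  moreover have "(\<lambda>p. K x (fst p)) \<in> borel_measurable (?L \<Otimes>\<^sub>M ?L)"
    by (rule measurable_compose[OF measurable_fst borel_measurable_K_right])
  moreover have "(\<lambda>p. phi (snd p)) \<in> borel_measurable (?L \<Otimes>\<^sub>M ?L)"
    by (rule measurable_compose[OF measurable_snd phi_measurable])
  ultimately have meas: "case_prod f \<in> borel_measurable (?L \<Otimes>\<^sub>M ?L)"
    unfolding f_def case_prod_beta by (intro borel_measurable_times)
  have f_int: "integrable (?L \<Otimes>\<^sub>M ?L) (case_prod f)"
  proof (rule LF.integrable_const_bound[of _ M, OF AE_I2 meas])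
    fix p assume p: "p \<in> space (?L \<Otimes>\<^sub>M ?L)"
    obtain y z where yz: "p = (y, z)" by (cases p)
    have z: "z \<in> {0..1}" using p by (auto simp: yz space_pair_measure space_restrict_space)
    have "\<bar>K x y * (K y z * phi z)\<bar> \<le> 1 * (1 * M)"
      unfolding abs_mult using abs_K_le[of x y] abs_K_le[of y z] abs_phi_le_M[OF z]
      by (intro mult_mono) auto
    then show "norm (case_prod f p) \<le> M" by (simp add: yz f_def)
  qed
  have k_eq: "(\<integral>y. f y z \<partial>?L) = phi z * k z" for z
  proof -
    have "(\<integral>y. f y z \<partial>?L) = (\<integral>y. phi z * (K z y * K x y) \<partial>?L)"
      by (intro Bochner_Integration.integral_cong) (auto simp: f_def K_commute[of z])
    also have "\<dots> = phi z * (\<integral>y. K z y * K x y \<partial>?L)" by simp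
    also have "(\<integral>y. K z y * K x y \<partial>?L) = k z"
      unfolding k_def using integrable_K_mult(1)[OF borel_measurable_K_right abs_K_le]
      by (intro lebesgue_integral_eq_integral) auto
    finally show ?thesis .
  qed
  have "phi x = lam * (\<integral>y. K x y * phi y \<partial>?L)" using x by (intro phi_eq_lebesgue) auto
  also have "(\<integral>y. K x y * phi y \<partial>?L) = (\<integral>y. lam * (\<integral>z. f y z \<partial>?L) \<partial>?L)"
  proof (rule Bochner_Integration.integral_cong)
    fix y assume "y \<in> space ?L"
    then have "y \<in> {0..1}" by simp
    then show "K x y * phi y = lam * (\<integral>z. f y z \<partial>?L)"
      unfolding f_def by (subst phi_eq_lebesgue) auto
  qed simp
  also have "\<dots> = lam * (\<integral>y. (\<integral>z. f y z \<partial>?L) \<partial>?L)" by simp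
  also have "(\<integral>y. (\<integral>z. f y z \<partial>?L) \<partial>?L) = (\<integral>z. (\<integral>y. f y z \<partial>?L) \<partial>?L)"
    using LL.Fubini_integral[OF f_int] by simp
  also have "\<dots> = (\<integral>z. phi z * k z \<partial>?L)" by (simp only: k_eq)
  finally have phi_x: "phi x = lam\<^sup>2 * (\<integral>z. phi z * k z \<partial>?L)" by (simp add: power2_eq_square)
  have int: "integrable ?L (\<lambda>z. phi z * k z)"
    using LL.integrable_snd[OF f_int] by (simp only: k_eq)
  have k_le: "\<bar>k z\<bar> \<le> sqrt (2 * x) * (1 / sqrt z)" if z: "0 < z" "z \<le> 1" for z
  proof -
    have "\<bar>k z\<bar> \<le> 2 * x / z" unfolding k_def by (rule abs_integral_K_K_le[OF x z])
    moreover have "\<bar>k z\<bar> \<le> 1"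
    proof -
      have "norm (k z) \<le> integral {0..1} (\<lambda>y::real. 1::real)"
        unfolding k_def
      proof (rule integral_norm_bound_integral[OF integrable_K_mult(2)[OF borel_measurable_K_right abs_K_le]])
        show "norm (K z y * K x y) \<le> 1" for y
          using mult_mono[OF abs_K_le[of z y] abs_K_le[of x y]] by (simp add: abs_mult)
      qed auto
      then show ?thesis by simp
    qed
    \<comment> \<open>The geometric mean of the bounds 1 and \<open>2 * x / z\<close> is taken,
      because \<open>1 / z\<close> is not integrable at 0 while \<open>1 / sqrt z\<close>
      is.\<close>
    ultimately have "\<bar>k z\<bar> * \<bar>k z\<bar> \<le> 1 * (2 * x / z)" by (intro mult_mono) auto
    then have "\<bar>k z\<bar> \<le> sqrt (2 * x / z)" by (intro real_le_rsqrt) (simp add: power2_eq_square)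
    then show ?thesis by (simp add: real_sqrt_divide)
  qed
  have i: "((\<lambda>z. M * sqrt (2 * x) * (1 / sqrt z)) has_integral M * sqrt (2 * x) * (2 * sqrt 1)) {0..1}"
    by (intro has_integral_mult_right has_integral_inverse_sqrt) auto
  have "\<bar>\<integral>z. phi z * k z \<partial>?L\<bar> = norm (integral {0..1} (\<lambda>z. phi z * k z))"
    by (simp add: lebesgue_integral_eq_integral[OF int])
  also have "\<dots> \<le> integral {0..1} (\<lambda>z. M * sqrt (2 * x) * (1 / sqrt z))"
  proof (rule integral_norm_bound_integral)
    show "(\<lambda>z. phi z * k z) integrable_on {0..1}" using int by (intro integrable_on_lebesgue_on) auto
    show "(\<lambda>z. M * sqrt (2 * x) * (1 / sqrt z)) integrable_on {0..1}" using i by blast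
    show "norm (phi z * k z) \<le> M * sqrt (2 * x) * (1 / sqrt z)" if z: "z \<in> {0..1}" for z
    proof (cases "z = 0")
      case True
      then show ?thesis by (simp add: k_def K_def)
    next
      case False
      then have "\<bar>phi z\<bar> * \<bar>k z\<bar> \<le> M * (sqrt (2 * x) * (1 / sqrt z))"
        using z by (intro mult_mono abs_phi_le_M k_le M_nonneg) auto
      then show ?thesis by (simp add: abs_mult)
    qed
  qed
  also have "\<dots> = M * sqrt (2 * x) * (2 * sqrt 1)" using i by (rule integral_unique)
  finally have "lam\<^sup>2 * \<bar>\<integral>z. phi z * k z \<partial>?L\<bar> \<le> lam\<^sup>2 * (M * sqrt (2 * x) * (2 * sqrt 1))"
    by (intro mult_left_mono) auto
  then show ?thesis unfolding phi_x by (simp add: abs_mult C_def real_sqrt_mult mult_ac)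
qed

text \<open>For fixed \<open>x > 0\<close> the kernel is continuous in its first argument at
  \<open>x\<close> for all but countably many \<open>y\<close>, so dominated convergence applies.
  Continuity at 0 comes from the decay.\<close>

lemma continuous_on_phi: "continuous_on {0..1} phi"
proof (rule continuous_on_of_decay[OF _ abs_phi_le])
  show "continuous_on {0<..1} phi"
    unfolding continuous_on_sequentially
  proof (intro allI ballI impI)
    fix u :: "nat \<Rightarrow> real" and x :: real
    assume x: "x \<in> {0<..1}" and u: "(\<forall>n. u n \<in> {0<..1}) \<and> u \<longlonglongrightarrow> x"
    have "(\<lambda>n. \<integral>y. K (u n) y * phi y \<partial>lebesgue_on {0..1}) \<longlonglongrightarrow> (\<integral>y. K x y * phi y \<partial>lebesgue_on {0..1})"
    proof (rule integral_dominated_convergence)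
      show "integrable (lebesgue_on {0..1}) (\<lambda>y. \<bar>phi y\<bar>)" using phi_integrable by simp
      show "(\<lambda>y. K x y * phi y) \<in> borel_measurable (lebesgue_on {0..1})"
        "(\<lambda>y. K (u n) y * phi y) \<in> borel_measurable (lebesgue_on {0..1})" for n
        by (intro borel_measurable_times borel_measurable_K_right phi_measurable)+
      show "AE y in lebesgue_on {0..1}. norm (K (u n) y * phi y) \<le> \<bar>phi y\<bar>" for n
      proof (rule AE_I2)
        show "norm (K (u n) y * phi y) \<le> \<bar>phi y\<bar>" for y
          using abs_K_le[of "u n" y] by (auto simp: abs_mult intro!: mult_left_le_one_le)
      qed
      have "AE y in lebesgue_on {0..1}. 1 / (x * y) \<notin> \<int>" using x by (intro AE_not_inverse_Ints) auto
      moreover have "AE y in lebesgue_on {0..1}. y \<in> {0..1}" by (intro AE_I2) simp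
      ultimately show "AE y in lebesgue_on {0..1}. (\<lambda>n. K (u n) y * phi y) \<longlonglongrightarrow> K x y * phi y"
      proof eventually_elim
        case (elim y)
        then have "y \<noteq> 0" by auto
        with elim x have "isCont (\<lambda>x. K x y) x" by (intro isCont_K_left) auto
        then have "(\<lambda>n. K (u n) y) \<longlonglongrightarrow> K x y" using u by (auto intro: isCont_tendsto_compose)
        then show ?case by (intro tendsto_intros)
      qed
    qed
    then have "(\<lambda>n. lam * (\<integral>y. K (u n) y * phi y \<partial>lebesgue_on {0..1})) \<longlonglongrightarrow> phi x"
      using x by (subst phi_eq_lebesgue) (auto intro: tendsto_mult_left)
    moreover have "lam * (\<integral>y. K (u n) y * phi y \<partial>lebesgue_on {0..1}) = phi (u n)" for n
      using u by (subst phi_eq_lebesgue[of "u n"]) (auto simp: less_imp_le)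
    ultimately show "(phi \<circ> u) \<longlonglongrightarrow> phi x" by (simp add: o_def)
  qed
qed

lemma phi_integrable_on: "b \<in> {0..1} \<Longrightarrow> phi integrable_on {0..b}"
  by (intro integrable_continuous_real continuous_on_subset[OF continuous_on_phi]) auto

section \<open>Series form of the eigenvalue equation and its term-by-term derivative\<close>

definition Phi :: "real \<Rightarrow> real" where "Phi y = integral {0..y} phi"

lemma abs_Phi_le:
  assumes "y \<in> {0..1}"
  shows "\<bar>Phi y\<bar> \<le> C * (y * sqrt y)"
proof -
  have "norm (Phi y) \<le> integral {0..y} (\<lambda>_. C * sqrt y)"
    unfolding Phi_def
  proof (rule integral_norm_bound_integral[OF phi_integrable_on[OF assms]])
    show "norm (phi t) \<le> C * sqrt y" if "t \<in> {0..y}" for t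
    proof -
      have "\<bar>phi t\<bar> \<le> C * sqrt t" using that assms by (intro abs_phi_le) auto
      also have "\<dots> \<le> C * sqrt y" using that C_nonneg by (intro mult_left_mono) auto
      finally show ?thesis by simp
    qed
  qed auto
  then show ?thesis using assms by (simp add: mult_ac)
qed

lemma Phi_has_derivative:
  assumes "0 < y" "y < 1"
  shows "(Phi has_real_derivative phi y) (at y)"
proof -
  have "(Phi has_real_derivative phi y) (at y within {0..1})"
    unfolding Phi_def[abs_def] using assms
    by (intro integral_has_real_derivative continuous_on_phi) auto
  then show ?thesis using assms at_within_interior[of y "{0..1}"] by (simp add: interior_atLeastAtMost_real)
qed

lemma dominated_Phi:
  assumes "0 < x" "x \<le> 1"
  shows "dominated_primitive x C Phi"
proof
  show "continuous_on {0..1} Phi"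
    unfolding Phi_def[abs_def] by (intro indefinite_integral_continuous_1 phi_integrable_on) auto
qed (use assms abs_Phi_le in auto)

lemma dominated_id_phi:
  assumes "0 < x" "x \<le> 1"
  shows "dominated_primitive x C (\<lambda>y. y * phi y)"
proof
  show "continuous_on {0..1} (\<lambda>y. y * phi y)" by (intro continuous_intros continuous_on_phi)
  show "\<bar>y * phi y\<bar> \<le> C * (y * sqrt y)" if "y \<in> {0..1}" for y
  proof -
    have "\<bar>y\<bar> * \<bar>phi y\<bar> \<le> y * (C * sqrt y)"
      using that abs_phi_le[OF that] by (intro mult_mono) auto
    then show ?thesis by (simp add: abs_mult mult_ac)
  qed
qed (use assms in auto)

text \<open>Integration by parts through the derivative of \<open>Phi t / t\<close>. It relates the
  integral terms of \<open>H\<close> for \<open>F = Phi\<close> and for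
  \<open>F y = y * phi y\<close>; the integrand stays uncancelled to match the latter. These
  integrals do not involve the kernel parameter, so 1 is as good as any.\<close>

lemma integral_phi_div:
  "integral {0..1} (\<lambda>t. t * phi t / t\<^sup>2) = Phi 1 + integral {0..1} (\<lambda>t. Phi t / t\<^sup>2)"
proof -
  interpret P: dominated_primitive 1 C Phi by (rule dominated_Phi) auto
  interpret T: dominated_primitive 1 C "\<lambda>y. y * phi y" by (rule dominated_id_phi) auto
  \<comment> \<open>The conventional value \<open>Phi 0 / 0 = 0\<close> is also the limit at 0, as
    \<open>Phi t / t\<close> is \<open>O(sqrt t)\<close>.\<close>
  have "((\<lambda>t. t * phi t / t\<^sup>2 - Phi t / t\<^sup>2) has_integral Phi 1 / 1 - Phi 0 / 0) {0..1}"
  proof (rule fundamental_theorem_of_calculus_interior)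
    show "continuous_on {0..1} (\<lambda>t. Phi t / t)"
    proof (rule continuous_on_of_decay)
      show "continuous_on {0<..1} (\<lambda>t. Phi t / t)"
        by (intro continuous_intros continuous_on_subset[OF P.cont]) auto
      show "\<bar>Phi t / t\<bar> \<le> C * sqrt t" if "t \<in> {0..1}" for t
      proof (cases "t = 0")
        case False
        then have "\<bar>Phi t / t\<bar> \<le> C * (t * sqrt t) / t"
          unfolding abs_divide using that abs_Phi_le[OF that] by (simp only: abs_of_nonneg atLeastAtMost_iff divide_right_mono)
        then show ?thesis using False by simp
      qed auto
    qed
    fix t :: real assume t: "t \<in> {0<..<1}"
    have "((\<lambda>t. Phi t / t) has_real_derivative (phi t * t - Phi t * 1) / (t * t)) (at t)"
      using t by (intro DERIV_divide Phi_has_derivative DERIV_ident) auto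
    then show "((\<lambda>t. Phi t / t) has_vector_derivative t * phi t / t\<^sup>2 - Phi t / t\<^sup>2) (at t)"
      by (simp add: has_real_derivative_iff_has_vector_derivative power2_eq_square diff_divide_distrib mult.commute)
  qed auto
  then have "integral {0..1} (\<lambda>t. t * phi t / t\<^sup>2 - Phi t / t\<^sup>2) = Phi 1" by (simp add: integral_unique)
  moreover have "integral {0..1} (\<lambda>t. t * phi t / t\<^sup>2 - Phi t / t\<^sup>2) =
      integral {0..1} (\<lambda>t. t * phi t / t\<^sup>2) - integral {0..1} (\<lambda>t. Phi t / t\<^sup>2)"
    by (intro integral_diff T.F_div_integrable P.F_div_integrable) auto
  ultimately show ?thesis by simp
qed

text \<open>The integration formula with \<open>F = Phi\<close>, evaluated through
  \<open>H 1\<close>. All dependence on \<open>x\<close> is now explicit once \<open>m\<close> is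
  fixed.\<close>

lemma phi_eq_series:
  assumes x: "0 < x" "x \<le> 1" and m: "real m \<le> 1 / x" "1 / x \<le> real m + 1"
  shows "phi x = lam * ((1/2 + real m - 1 / x) * Phi 1 + (\<Sum>n. Phi (1 / (real (Suc (n + m)) * x)))
      - integral {0..1} (\<lambda>t. Phi t / t\<^sup>2) / x)"
proof -
  interpret P: dominated_primitive x C Phi by (rule dominated_Phi[OF x])
  have "integral {0..1} (\<lambda>y. K x y * phi y) = P.H 1"
    by (rule P.integral_K_mult[where S = "{}"]) (auto intro: Phi_has_derivative K_phi_integrable_on)
  then show ?thesis
    using phi_eq[of x] P.H_eq[of 1 m] x m by (simp add: P.a_def)
qed

text \<open>The value of \<open>x * phi' x\<close>. At the points \<open>x = 1 / m\<close> it is the left derivative that is meant,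
  since \<open>K _ 1\<close> is left continuous.\<close>

definition R :: "real \<Rightarrow> real" where
  "R x = lam * (phi 1 * K x 1 - dominated_primitive.H x (\<lambda>y. y * phi y) 1)"

text \<open>\<open>g\<close> is the series with \<open>m\<close> frozen, differentiable on both
  sides of \<open>x\<close> even when \<open>x = 1 / real m\<close>. Differentiating the term at
  \<open>v = 1 / (real (Suc (n + m)) * u)\<close> gives \<open>- v * phi v / u\<close>, so the jump
  sum for \<open>y * phi y\<close> appears.\<close>

lemma phi_eq_differentiable:
  assumes x: "0 < x" "x \<le> 1" and m: "1 \<le> m" "real m \<le> 1 / x" "1 / x < real m + 1"
  obtains g where "(g has_real_derivative R x / x) (at x)"
    and "\<And>u. u \<in> {1 / (real m + 1)<..1 / real m} \<Longrightarrow> phi u = g u"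
proof -
  \<comment> \<open>For \<open>u > c\<close> all arguments of \<open>Phi\<close> in the series stay
    below 1, where \<open>Phi\<close> is differentiable.\<close>
  define c where "c = 1 / (real m + 1)"
  define J where "J = integral {0..1} (\<lambda>t. Phi t / t\<^sup>2)"
  define S where "S u = (\<Sum>n. Phi (1 / (real (Suc (n + m)) * u)))" for u
  define S' where "S' n u = - phi (1 / (real (Suc (n + m)) * u)) / (real (Suc (n + m)) * u\<^sup>2)" for n u
  have c: "0 < c" "c < x" "c \<le> 1" using x m by (auto simp: c_def field_simps)
  have arg: "1 / (real (Suc (n + m)) * u) \<in> {0<..<1}"
    "1 / (real (Suc (n + m)) * u) \<le> 1 / (real (Suc (n + m)) * c)"
    "1 / (real (Suc (n + m)) * c) \<le> 1" if u: "c < u" for n u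
  proof -
    have "1 \<le> real (Suc (n + m)) * c" using c by (simp add: c_def field_simps)
    moreover have "real (Suc (n + m)) * c < real (Suc (n + m)) * u" using u by simp
    moreover have "1 / q \<in> {0<..<1} \<and> 1 / q \<le> 1 / p \<and> 1 / p \<le> 1" if "1 \<le> p" "p < q" for p q :: real
      using that by (auto simp: divide_simps)
    ultimately show "1 / (real (Suc (n + m)) * u) \<in> {0<..<1}"
      "1 / (real (Suc (n + m)) * u) \<le> 1 / (real (Suc (n + m)) * c)"
      "1 / (real (Suc (n + m)) * c) \<le> 1"
      by blast+
  qed
  \<comment> \<open>The kernel parameter \<open>c\<close> supplies a summable majorant that holds
    for all \<open>u > c\<close> at once.\<close>
  interpret Pc: dominated_primitive c C Phi using c by (intro dominated_Phi) auto
  let ?w = "\<lambda>n. 1 / (real (Suc (n + m)) * c)"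
  have summ: "summable (\<lambda>n. C * (?w n * sqrt (?w n)) / c)"
  proof -
    have "summable (\<lambda>n. C * (min 1 (Pc.a n) * sqrt (min 1 (Pc.a n))))"
      by (rule Pc.summable_dom) simp
    then have "summable (\<lambda>n. C * (min 1 (Pc.a (n + m)) * sqrt (min 1 (Pc.a (n + m)))))"
      by (subst summable_iff_shift)
    moreover have "min 1 (Pc.a (n + m)) = ?w n" for n
      using arg(3)[OF c(2)] by (simp add: Pc.a_def)
    ultimately show ?thesis by (intro summable_divide) simp
  qed
  have S': "(S has_real_derivative (\<Sum>n. S' n x)) (at x)"
    unfolding S_def[abs_def]
  proof (rule has_field_derivative_series'(2))
    \<comment> \<open>The right end 2 only serves to make \<open>x = 1\<close> an interior
      point.\<close>
    show "convex {c<..<2}" by simp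
    show "((\<lambda>u. Phi (1 / (real (Suc (n + m)) * u))) has_real_derivative S' n u) (at u within {c<..<2})"
      if u: "u \<in> {c<..<2}" for n u
    proof -
      have "((\<lambda>u. 1 / (real (Suc (n + m)) * u)) has_real_derivative - 1 / (real (Suc (n + m)) * u\<^sup>2)) (at u)"
        using u c by (intro DERIV_inverse_mult) auto
      from DERIV_chain2[OF Phi_has_derivative this] arg(1)[of u n] u
      show ?thesis by (auto simp: S'_def intro: has_field_derivative_at_within)
    qed
    show "uniformly_convergent_on {c<..<2} (\<lambda>n u. \<Sum>i<n. S' i u)"
    proof (rule Weierstrass_m_test'[OF _ summ])
      fix n u assume u: "u \<in> {c<..<2}"
      define v where "v = 1 / (real (Suc (n + m)) * u)"
      have v: "0 < v" "v < 1" "v \<le> ?w n" using arg[of u n] u by (auto simp: v_def)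
      have "norm (S' n u) = v * \<bar>phi v\<bar> / u"
        using u c by (simp add: S'_def v_def abs_mult power2_eq_square)
      also have "\<dots> \<le> C * (?w n * sqrt (?w n)) / c"
      proof (rule frac_le)
        have "v * \<bar>phi v\<bar> \<le> ?w n * (C * sqrt (?w n))"
        proof (rule mult_mono)
          have "\<bar>phi v\<bar> \<le> C * sqrt v" using v by (intro abs_phi_le) auto
          also have "\<dots> \<le> C * sqrt (?w n)" using v C_nonneg by (intro mult_left_mono) auto
          finally show "\<bar>phi v\<bar> \<le> C * sqrt (?w n)" .
        qed (use v c in auto)
        then show "v * \<bar>phi v\<bar> \<le> C * (?w n * sqrt (?w n))" by (simp add: mult_ac)
      qed (use u c v C_nonneg in auto)
      finally show "norm (S' n u) \<le> C * (?w n * sqrt (?w n)) / c" .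
    qed
    show "x \<in> {c<..<2}" using c x by auto
    then show "x \<in> interior {c<..<2}" by (simp add: interior_open)
    interpret P: dominated_primitive x C Phi by (rule dominated_Phi[OF x])
    show "summable (\<lambda>n. Phi (1 / (real (Suc (n + m)) * x)))"
      using P.sum_F_min_eq(2)[of 1 m] m by (simp add: P.a_def)
  qed
  define g where "g u = lam * ((1/2 + real m - 1 / u) * Phi 1 + S u - J / u)" for u
  show ?thesis
  proof
    interpret T: dominated_primitive x C "\<lambda>y. y * phi y" by (rule dominated_id_phi[OF x])
    have "((\<lambda>u. (1/2 + real m - 1 / u) * Phi 1) has_real_derivative 1 / x\<^sup>2 * Phi 1) (at x)"
      using x by (auto intro!: derivative_eq_intros simp: power2_eq_square)
    moreover have "((\<lambda>u. J / u) has_real_derivative - J / x\<^sup>2) (at x)"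
      using x by (auto intro!: derivative_eq_intros simp: power2_eq_square)
    ultimately have "(g has_real_derivative lam * (1 / x\<^sup>2 * Phi 1 + (\<Sum>n. S' n x) - (- J / x\<^sup>2))) (at x)"
      unfolding g_def[abs_def] by (intro DERIV_cmult DERIV_add DERIV_diff S')
    moreover have "lam * (1 / x\<^sup>2 * Phi 1 + (\<Sum>n. S' n x) - (- J / x\<^sup>2)) = R x / x"
    proof -
      have s: "summable (\<lambda>n. T.a (n + m) * phi (T.a (n + m)))"
        using T.sum_F_min_eq(2)[of 1 m] m by simp
      have "(\<Sum>n. S' n x) = (\<Sum>n. - 1 / x * (T.a (n + m) * phi (T.a (n + m))))"
        using x by (simp add: S'_def T.a_def power2_eq_square mult_ac)
      also have "\<dots> = - 1 / x * (\<Sum>n. T.a (n + m) * phi (T.a (n + m)))"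
        by (rule suminf_mult[OF s])
      finally have 1: "(\<Sum>n. S' n x) = - 1 / x * (\<Sum>n. T.a (n + m) * phi (T.a (n + m)))" .
      have K1: "K x 1 = 1/2 + real m - 1 / x" using K_eq[of x 1 m] x m by simp
      \<comment> \<open>The boundary term \<open>K x 1 * phi 1\<close> is exactly the one that
        \<open>R\<close> removes; what remains is \<open>x\<close> times the derivative of
        \<open>g\<close>.\<close>
      have "T.H 1 = K x 1 * phi 1 + (\<Sum>n. T.a (n + m) * phi (T.a (n + m))) - (Phi 1 + J) / x"
        using T.H_eq[of 1 m] m unfolding K1 integral_phi_div J_def by simp
      then have Rx: "R x = lam * ((Phi 1 + J) / x - (\<Sum>n. T.a (n + m) * phi (T.a (n + m))))"
        unfolding R_def by simp
      show ?thesis unfolding 1 Rx using x by (simp add: field_simps power2_eq_square)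
    qed
    ultimately show "(g has_real_derivative R x / x) (at x)" by simp
    fix u assume u: "u \<in> {1 / (real m + 1)<..1 / real m}"
    have "0 < u" using u c(1) unfolding c_def[symmetric] by auto
    have "1 / real m \<le> 1" using m by simp
    then have "u \<le> 1" using u by simp
    moreover have "real m \<le> 1 / u" "1 / u \<le> real m + 1" using u \<open>0 < u\<close> m by (auto simp: field_simps)
    ultimately show "phi u = g u"
      unfolding g_def S_def J_def using \<open>0 < u\<close> by (intro phi_eq_series) auto
  qed
qed

text \<open>On the left neighbourhood \<open>U\<close> of \<open>x\<close> the functions
  \<open>phi\<close> and \<open>g\<close> agree, and one-sided derivatives are unique. So a
  derivative at some \<open>1 / real m\<close>, if it exists, is also given by
  \<open>R\<close>.\<close>

lemma deriv_phi_eq: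
  assumes x: "0 < x" "x \<le> 1" and D: "(phi has_real_derivative D) (at x within {0..1})"
  shows "x * D = R x"
proof -
  obtain m :: nat where m: "1 \<le> m" "real m \<le> 1 / x" "1 / x < real m + 1"
    using inverse_floor_bounds[OF x] by blast
  obtain g where g: "(g has_real_derivative R x / x) (at x)"
    "\<And>u. u \<in> {1 / (real m + 1)<..1 / real m} \<Longrightarrow> phi u = g u"
    using phi_eq_differentiable[OF x m] by blast
  have xm: "1 / (real m + 1) < x" "x \<le> 1 / real m" using x m by (auto simp: field_simps)
  define U where "U = {1 / (real m + 1)<..x}"
  have "(g has_real_derivative R x / x) (at x within U)" using g(1) by (rule has_field_derivative_at_within)
  then have "(phi has_real_derivative R x / x) (at x within U)"
    by (rule has_field_derivative_transform_within[of _ _ _ _ 1]) (use g(2) xm in \<open>auto simp: U_def\<close>)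
  moreover have "U \<subseteq> {0..1}"
  proof
    fix u assume "u \<in> U"
    moreover have "0 \<le> 1 / (real m + 1)" by simp
    ultimately have "0 \<le> u" "u \<le> 1" using x unfolding U_def greaterThanAtMost_iff by linarith+
    then show "u \<in> {0..1}" by simp
  qed
  with D have "(phi has_real_derivative D) (at x within U)" by (rule DERIV_subset)
  moreover have "at x within U \<noteq> bot"
    using xm unfolding U_def by (simp add: trivial_limit_within)
  ultimately have "D = R x / x"
    unfolding has_real_derivative_iff_has_vector_derivative by (metis vector_derivative_unique_within)
  then show ?thesis using x by simp
qed

text \<open>Away from the points \<open>1 / real m\<close>, \<open>x\<close> is interior to its
  band, so \<open>phi = g\<close> near \<open>x\<close>.\<close>

lemma phi_has_derivative:
  assumes x: "0 < x" "x < 1" "1 / x \<notin> \<int>"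
  shows "(phi has_real_derivative R x / x) (at x)"
proof -
  obtain m :: nat where m: "1 \<le> m" "real m \<le> 1 / x" "1 / x < real m + 1"
    using inverse_floor_bounds[of x] x by auto
  obtain g where g: "(g has_real_derivative R x / x) (at x)"
    "\<And>u. u \<in> {1 / (real m + 1)<..1 / real m} \<Longrightarrow> phi u = g u"
    using phi_eq_differentiable[of x m] x m by auto
  have "real m \<noteq> 1 / x" using x(3) by (metis Ints_of_nat)
  then have "real m < 1 / x" using m by simp
  then have "x \<in> {1 / (real m + 1)<..<1 / real m}" using x m by (auto simp: field_simps)
  from g(1) _ this show ?thesis
    by (rule has_field_derivative_transform_within_open) (use g(2) in auto)
qed

lemma id_phi_has_derivative:
  assumes "0 < y" "y < 1" "1 / y \<notin> \<int>"
  shows "((\<lambda>y. y * phi y) has_real_derivative phi y + R y) (at y)"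
proof -
  have "((\<lambda>y. y * phi y) has_real_derivative 1 * phi y + R y / y * y) (at y)"
    by (intro DERIV_mult DERIV_ident phi_has_derivative assms)
  then show ?thesis using assms by simp
qed

section \<open>Growth of \<open>R\<close> near 0\<close>

definition C1 :: real where "C1 = \<bar>lam\<bar> * (\<bar>phi 1\<bar> + 9 * C)"

lemma C1_nonneg: "0 \<le> C1"
  using C_nonneg by (simp add: C1_def)

text \<open>A first crude bound, from \<open>abs_H_le\<close> at \<open>y = 1\<close>; it is not
  integrable at 0 and has to be sharpened.\<close>

lemma abs_R_le_inverse:
  assumes x: "0 < x" "x \<le> 1"
  shows "\<bar>R x\<bar> \<le> C1 / x"
proof -
  interpret T: dominated_primitive x C "\<lambda>y. y * phi y" by (rule dominated_id_phi[OF x])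
  have 1: "\<bar>phi 1 * K x 1\<bar> \<le> \<bar>phi 1\<bar> / x"
  proof -
    have "\<bar>phi 1\<bar> * \<bar>K x 1\<bar> \<le> \<bar>phi 1\<bar> * (1 / x)"
    proof (rule mult_left_mono)
      have "1 \<le> 1 / x" using x by simp
      then show "\<bar>K x 1\<bar> \<le> 1 / x" using abs_K_le[of x 1] by linarith
    qed auto
    then show ?thesis by (simp add: abs_mult)
  qed
  have 2: "\<bar>T.H 1\<bar> \<le> 9 * C / x" using T.abs_H_le[of 1] by simp
  have "\<bar>phi 1 * K x 1 - T.H 1\<bar> \<le> (\<bar>phi 1\<bar> + 9 * C) / x"
    unfolding add_divide_distrib using 1 2 by linarith
  then have "\<bar>lam\<bar> * \<bar>phi 1 * K x 1 - T.H 1\<bar> \<le> \<bar>lam\<bar> * ((\<bar>phi 1\<bar> + 9 * C) / x)"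
    by (rule mult_left_mono) simp
  then show ?thesis by (simp add: R_def C1_def abs_mult)
qed

text \<open>The summands bound, in order, the boundary term \<open>phi 1 * K x 1\<close>, the value
  \<open>H x\<close>, and the integral over \<open>{x..1}\<close>.\<close>

definition C2 :: real where "C2 = \<bar>lam\<bar> * (\<bar>phi 1\<bar> + 9 * C + 2 * (M + C1))"

text \<open>The bound \<open>C1 / y\<close> improves itself: it controls the integral over \<open>{x..1}\<close>, while \<open>H x\<close>
  controls the rest.\<close>

lemma abs_R_le:
  assumes x: "0 < x" "x \<le> 1"
  shows "\<bar>R x\<bar> \<le> C2 * (1 / sqrt x)"
proof -
  interpret T: dominated_primitive x C "\<lambda>y. y * phi y" by (rule dominated_id_phi[OF x])
  have s: "1 \<le> 1 / sqrt x" using x by simp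
  have 1: "\<bar>phi 1 * K x 1\<bar> \<le> \<bar>phi 1\<bar> * (1 / sqrt x)"
    unfolding abs_mult using abs_K_le[of x 1] s by (intro mult_left_mono) linarith+
  have 2: "\<bar>T.H x\<bar> \<le> 9 * C * (1 / sqrt x)"
  proof -
    have "9 * C * sqrt x / x = 9 * C * sqrt x / (sqrt x * sqrt x)" using x by simp
    also have "\<dots> = 9 * C * (1 / sqrt x)" using x by (simp del: real_sqrt_mult_self)
    finally show ?thesis using T.abs_H_le[OF x] by linarith
  qed
  have hi: "((\<lambda>y. K x y * (phi y + R y)) has_integral T.H 1 - T.H x) {x..1}"
    using x by (intro T.has_integral_K_mult[where S = "{y. 1 / y \<in> \<int>}"] finite_inverse_Ints_1 id_phi_has_derivative) auto
  have i: "((\<lambda>y. (M + C1) * (1 / sqrt x) * (1 / sqrt y)) has_integral (M + C1) * (1 / sqrt x) * (2 * sqrt 1)) {0..1}"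
    by (intro has_integral_mult_right has_integral_inverse_sqrt) auto
  have ix: "(\<lambda>y. (M + C1) * (1 / sqrt x) * (1 / sqrt y)) integrable_on {x..1}"
    using has_integral_integrable[OF i] by (rule integrable_subinterval_real) (use x in auto)
  have "\<bar>T.H 1 - T.H x\<bar> = norm (integral {x..1} (\<lambda>y. K x y * (phi y + R y)))"
    using hi by (simp add: integral_unique)
  also have "\<dots> \<le> integral {x..1} (\<lambda>y. (M + C1) * (1 / sqrt x) * (1 / sqrt y))"
  proof (rule integral_norm_bound_integral)
    show "(\<lambda>y. K x y * (phi y + R y)) integrable_on {x..1}" using hi by blast
    fix y assume y: "y \<in> {x..1}"
    have "0 < y" using x y by auto
    have "\<bar>phi y + R y\<bar> \<le> M + C1 / y"
      using abs_phi_le_M[of y] abs_R_le_inverse[of y] \<open>0 < y\<close> y by auto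
    also have "\<dots> \<le> (M + C1) * (1 / y)"
    proof -
      have "M * 1 \<le> M * (1 / y)" using M_nonneg y \<open>0 < y\<close> by (intro mult_left_mono) auto
      then show ?thesis by (simp add: add_divide_distrib)
    qed
    also have "\<dots> \<le> (M + C1) * ((1 / sqrt x) * (1 / sqrt y))"
    proof (rule mult_left_mono)
      \<comment> \<open>One of the two factors is bounded by its value at \<open>x \<le> y\<close>;
        the other remains integrable down to 0.\<close>
      have "1 / y = (1 / sqrt y) * (1 / sqrt y)" using \<open>0 < y\<close> by simp
      also have "\<dots> \<le> (1 / sqrt x) * (1 / sqrt y)"
        using y x \<open>0 < y\<close> by (intro mult_right_mono divide_left_mono) auto
      finally show "1 / y \<le> (1 / sqrt x) * (1 / sqrt y)" .
    qed (use M_nonneg C1_nonneg in auto)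
    finally have le: "\<bar>phi y + R y\<bar> \<le> (M + C1) * ((1 / sqrt x) * (1 / sqrt y))" .
    have "\<bar>K x y\<bar> * \<bar>phi y + R y\<bar> \<le> 1 * ((M + C1) * ((1 / sqrt x) * (1 / sqrt y)))"
      using abs_K_le[of x y] le by (intro mult_mono) auto
    then show "norm (K x y * (phi y + R y)) \<le> (M + C1) * (1 / sqrt x) * (1 / sqrt y)"
      by (simp add: abs_mult)
  qed (rule ix)
  also have "\<dots> \<le> integral {0..1} (\<lambda>y. (M + C1) * (1 / sqrt x) * (1 / sqrt y))"
    using x i ix M_nonneg C1_nonneg by (intro integral_subset_le) auto
  also have "\<dots> = 2 * (M + C1) * (1 / sqrt x)" using i by (simp add: integral_unique)
  finally have 3: "\<bar>T.H 1 - T.H x\<bar> \<le> 2 * (M + C1) * (1 / sqrt x)" .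
  have "\<bar>phi 1 * K x 1 - T.H 1\<bar> \<le> \<bar>phi 1\<bar> * (1 / sqrt x) + 9 * C * (1 / sqrt x) + 2 * (M + C1) * (1 / sqrt x)"
    using 1 2 3 by linarith
  then have "\<bar>lam\<bar> * \<bar>phi 1 * K x 1 - T.H 1\<bar> \<le>
      \<bar>lam\<bar> * (\<bar>phi 1\<bar> * (1 / sqrt x) + 9 * C * (1 / sqrt x) + 2 * (M + C1) * (1 / sqrt x))"
    by (rule mult_left_mono) simp
  then show ?thesis
    unfolding R_def C2_def abs_mult[of lam] by (simp only: distrib_left distrib_right mult.assoc)
qed

section \<open>The function \<open>Qfun phi\<close> and the final identity\<close>

lemma Qfun_eq_R:
  assumes y: "0 < y" "y \<le> 1" and D: "(phi has_real_derivative D) (at y within {0..1})"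
  shows "Qfun phi y = R y"
proof -
  have "(THE D. (phi has_real_derivative D) (at y within {0..1})) = R y / y"
  proof (rule the_equality)
    have *: "D = R y / y" if "(phi has_real_derivative D) (at y within {0..1})" for D
      using deriv_phi_eq[OF y that] y by (simp add: field_simps)
    show "(phi has_real_derivative R y / y) (at y within {0..1})" using D *[OF D] by simp
    show "(phi has_real_derivative D) (at y within {0..1}) \<Longrightarrow> D = R y / y" for D by (rule *)
  qed
  then show ?thesis using D y by (auto simp: Qfun_def)
qed

lemma Qfun_eq_R_generic:
  assumes "0 < y" "y < 1" "1 / y \<notin> \<int>"
  shows "Qfun phi y = R y"
  using assms phi_has_derivative[OF assms]
  by (intro Qfun_eq_R[of _ "R y / y"]) (auto intro: has_field_derivative_at_within)

text \<open>Where the derivative is missing, \<open>Qfun phi\<close> is 0 and the bound is trivial;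
  at \<open>y = 0\<close> both sides are 0.\<close>

lemma abs_Qfun_le:
  assumes "y \<in> {0..1}"
  shows "\<bar>Qfun phi y\<bar> \<le> C2 * (1 / sqrt y)"
proof (cases "y = 0")
  case True
  then show ?thesis by (simp add: Qfun_def)
next
  case False
  with assms have y: "0 < y" "y \<le> 1" by auto
  show ?thesis
  proof (cases "\<exists>D. (phi has_real_derivative D) (at y within {0..1})")
    case True
    then have "Qfun phi y = R y" using Qfun_eq_R[OF y] by auto
    then show ?thesis using abs_R_le[OF y] by simp
  next
    case False
    then have "Qfun phi y = 0" unfolding Qfun_def by (rule if_not_P)
    then show ?thesis using abs_R_le[OF y] by linarith
  qed
qed

text \<open>On \<open>{e..1}\<close> the product with \<open>Qfun phi\<close> is integrable as a
  difference: \<open>H\<close> is a primitive of \<open>K x y * (phi y + Qfun phi y)\<close>, and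
  \<open>K x y * phi y\<close> is known to be integrable. Truncations dominated by
  \<open>C2 / sqrt y\<close> carry this to \<open>{0..1}\<close>, where the integration formula
  applies with \<open>F y = y * phi y\<close>.\<close>

lemma
  assumes x: "0 < x" "x \<le> 1"
  shows integrable_K_Q: "integrable (lebesgue_on {0..1}) (\<lambda>y. K x y * Qfun phi y)"
    and integral_K_phi_plus_Q: "integral {0..1} (\<lambda>y. K x y * (phi y + Qfun phi y)) = dominated_primitive.H x (\<lambda>y. y * phi y) 1"
proof -
  interpret T: dominated_primitive x C "\<lambda>y. y * phi y" by (rule dominated_id_phi[OF x])
  let ?S = "{y. 1 / y \<in> \<int>} :: real set"
  have F': "((\<lambda>y. y * phi y) has_real_derivative phi y + Qfun phi y) (at y)"
    if "0 < y" "y < 1" "y \<notin> ?S" for y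
    using id_phi_has_derivative[of y] Qfun_eq_R_generic[of y] that by simp
  have KQ_le: "\<bar>K x y * Qfun phi y\<bar> \<le> C2 * (1 / sqrt y)" if "y \<in> {0..1}" for y
    using mult_mono[OF order_trans[OF abs_K_le[of x y], of 1] abs_Qfun_le[OF that]]
    by (simp add: abs_mult)
  have i: "(\<lambda>y. C2 * (1 / sqrt y)) integrable_on {0..1}"
    using has_integral_mult_right[OF has_integral_inverse_sqrt[of 1]] by (auto simp: has_integral_iff)
  have int: "(\<lambda>y. K x y * Qfun phi y) integrable_on {0..1}"
  proof (rule dominated_convergence(1)[OF _ i])
    let ?f = "\<lambda>k y. if y \<in> {1 / real (Suc k)..1} then K x y * Qfun phi y else 0"
    show "?f k integrable_on {0..1}" for k
    proof -
      define e where "e = 1 / real (Suc k)"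
      have e: "0 < e" "e \<le> 1" by (auto simp: e_def)
      have "(\<lambda>y. K x y * (phi y + Qfun phi y)) integrable_on {e..1}"
        using T.has_integral_K_mult[of e 1 ?S "\<lambda>y. phi y + Qfun phi y"] e F' finite_inverse_Ints_1[OF e(1)] by blast
      moreover have "(\<lambda>y. K x y * phi y) integrable_on {e..1}"
        using K_phi_integrable_on by (rule integrable_subinterval_real) (use e in auto)
      ultimately have "(\<lambda>y. K x y * (phi y + Qfun phi y) - K x y * phi y) integrable_on {e..1}"
        by (rule integrable_diff)
      then have "(\<lambda>y. K x y * Qfun phi y) integrable_on {e..1}" by (simp add: algebra_simps)
      moreover have "{e..1} \<inter> {0..1} = {e..1}" using e by auto
      ultimately show ?thesis unfolding e_def[symmetric] integrable_restrict_Int by (simp only:)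
    qed
    show "norm (?f k y) \<le> C2 * (1 / sqrt y)" if "y \<in> {0..1}" for k y
      using KQ_le[OF that] by (auto simp del: abs_mult)
    show "(\<lambda>k. ?f k y) \<longlonglongrightarrow> K x y * Qfun phi y" if y: "y \<in> {0..1}" for y
    proof (cases "y = 0")
      case True
      then show ?thesis by (simp add: K_def)
    next
      case False
      with y have "0 < y" by auto
      then obtain N where N: "inverse (real (Suc N)) < y" using reals_Archimedean by blast
      have "\<forall>\<^sub>F k in sequentially. K x y * Qfun phi y = ?f k y"
        using eventually_ge_at_top[of N]
      proof eventually_elim
        case (elim k)
        then have "1 / real (Suc k) \<le> 1 / real (Suc N)" by (simp add: frac_le)
        then have "1 / real (Suc k) \<le> y" using N unfolding inverse_eq_divide by linarith
        then show ?case using y by simp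
      qed
      then show ?thesis by (rule Lim_transform_eventually[OF tendsto_const])
    qed
  qed
  \<comment> \<open>The majorant upgrades gauge integrability to Lebesgue integrability, the notion
    used in \<open>Pfun\<close>.\<close>
  have "(\<lambda>y. K x y * Qfun phi y) absolutely_integrable_on {0..1}"
    using int i KQ_le by (intro absolutely_integrable_integrable_bound[where g = "\<lambda>y. C2 * (1 / sqrt y)"]) auto
  then show "integrable (lebesgue_on {0..1}) (\<lambda>y. K x y * Qfun phi y)"
    by (simp add: integrable_restrict_space set_integrable_def)
  show "integral {0..1} (\<lambda>y. K x y * (phi y + Qfun phi y)) = T.H 1"
  proof (rule T.integral_K_mult[where S = ?S])
    show "(\<lambda>y. K x y * (phi y + Qfun phi y)) integrable_on {0..1}"
      using integrable_add[OF K_phi_integrable_on[of x] int] by (simp add: algebra_simps)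
  qed (use finite_inverse_Ints_1 F' in auto)
qed

text \<open>Splitting the integral against \<open>phi y + Qfun phi y\<close> gives
  \<open>Pfun phi lam x = phi x - lam * H 1\<close>, and \<open>x * D = R x\<close> is
  \<open>lam * (phi 1 * K x 1 - H 1)\<close> with the same \<open>H 1\<close>; eliminating it leaves
  the claim.\<close>

lemma derivative_identity:
  assumes x: "0 < x" "x \<le> 1" and D: "(phi has_real_derivative D) (at x within {0..1})"
  shows "x * D + phi x - lam * phi 1 * K x 1 = Pfun phi lam x"
proof -
  note KQ = integrable_K_Q[OF x] integral_K_phi_plus_Q[OF x]
  have "(\<lambda>y. K x y * Qfun phi y) integrable_on {0..1}"
    using KQ(1) by (intro integrable_on_lebesgue_on) auto
  then have "integral {0..1} (\<lambda>y. K x y * phi y + K x y * Qfun phi y) =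
      integral {0..1} (\<lambda>y. K x y * phi y) + integral {0..1} (\<lambda>y. K x y * Qfun phi y)"
    by (intro integral_add K_phi_integrable_on)
  then have "integral {0..1} (\<lambda>y. K x y * Qfun phi y) =
      dominated_primitive.H x (\<lambda>y. y * phi y) 1 - integral {0..1} (\<lambda>y. K x y * phi y)"
    using KQ(2) by (simp add: distrib_left)
  then have "Pfun phi lam x = phi x - lam * dominated_primitive.H x (\<lambda>y. y * phi y) 1"
    using phi_eq[of x] x by (simp add: Pfun_def lebesgue_integral_eq_integral[OF KQ(1)] right_diff_distrib)
  then show ?thesis using deriv_phi_eq[OF x D] by (simp add: R_def algebra_simps)
qed

end

theorem theorem4p13:
  fixes phi :: "nat \<Rightarrow> real \<Rightarrow> real" and lam :: "nat \<Rightarrow> real"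
    and j :: nat and x D :: real
  assumes "max_ON_eigensystem phi lam"
    and "j \<ge> 1"
    and "0 < x" and "x \<le> 1"
    and "(phi j has_real_derivative D) (at x within {0..1})"
  shows "x * D + phi j x - lam j * phi j 1 * K x 1 = Pfun (phi j) (lam j) x"
proof -
  interpret K_eigenfunction "phi j" "lam j"
    using assms(1,2) by unfold_locales (simp add: max_ON_eigensystem_def)
  show ?thesis using assms(3-5) by (rule derivative_identity)
qed

end
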